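(* For any PSD Toeplitz matrix $T\in\mathbb{R}^{d\times d}$, any $\epsilon,\delta\in(0,1)$ and any integer $k\le d$, there exists a symmetric Toeplitz matrix $\widetilde T\in\mathbb{R}^{d\times d}$ of rank $\widetilde O\!\left(\frac{k\log(1/\delta)}{\epsilon}\right)$ such that $$\|T-\widetilde T\|_F\le(1+\epsilon)\|T-T_k\|_F+\delta\|T\|_F,$$ where $T_k=\arg\min_{B:\operatorname{rank}(B)\le k}\|T-B\|_F$ is the best rank-$k$ approximation of $T$ in Frobenius norm.
   Context: A matrix $T\in\mathbb{R}^{d\times d}$ is Toeplitz if $T_{i,j}=T_{k,l}$ whenever $i-j=k-l$. $\|\cdot\|_F$ is the Frobenius norm. The notation $\widetilde O(\cdot)$ hides factors polylogarithmic in its argument and in $d$. *)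

theory Defs
  imports Complex_Main "Jordan_Normal_Form.DL_Rank"
begin

text \<open>Matrices are carrier-based, because the constants hidden in the soft-O bound must be
  chosen before the dimension \<open>d\<close>. Indices therefore run over \<open>0, \<dots>, d - 1\<close>.\<close>

definition toeplitz_mat :: "'a mat \<Rightarrow> bool" where
  "toeplitz_mat A \<longleftrightarrow>
     (\<forall>i < dim_row A. \<forall>j < dim_col A. \<forall>k < dim_row A. \<forall>l < dim_col A.
        int i - int j = int k - int l \<longrightarrow> A $$ (i, j) = A $$ (k, l))"

definition sym_mat :: "'a mat \<Rightarrow> bool" where
  "sym_mat A \<longleftrightarrow> transpose_mat A = A"

definition psd_mat :: "real mat \<Rightarrow> bool" where
  "psd_mat A \<longleftrightarrow> sym_mat A \<and> (\<forall>v \<in> carrier_vec (dim_row A). 0 \<le> v \<bullet> (A *\<^sub>v v))"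

definition frobenius_norm :: "real mat \<Rightarrow> real" where
  "frobenius_norm A = sqrt (\<Sum>i < dim_row A. \<Sum>j < dim_col A. (A $$ (i, j))\<^sup>2)"

abbreviation mat_rank :: "real mat \<Rightarrow> nat" where
  "mat_rank A \<equiv> vec_space.rank (dim_row A) A"

definition best_rank_approx :: "nat \<Rightarrow> real mat \<Rightarrow> real mat \<Rightarrow> bool" where
  "best_rank_approx k A A' \<longleftrightarrow>
     is_arg_min (\<lambda>B. frobenius_norm (A - B))
       (\<lambda>B. B \<in> carrier_mat (dim_row A) (dim_col A) \<and> mat_rank B \<le> k) A'"

text \<open>\<open>soft_O C c d x\<close> is the bound \<open>C x polylog(x) polylog(d)\<close>, where the constant \<open>C\<close> and the
  degree \<open>c\<close> of the logarithms are to be quantified outside all other parameters. The logarithms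
  are shifted by 2 so that they stay bounded away from 0 for small \<open>x\<close> and \<open>d\<close>. The
  argument is rounded up: up to the constant this changes nothing for \<open>x \<ge> 1\<close> or \<open>x = 0\<close>, and for
  \<open>0 < x < 1\<close> it keeps an integer quantity such as a rank from being forced to 0.\<close>

definition soft_O :: "real \<Rightarrow> nat \<Rightarrow> nat \<Rightarrow> real \<Rightarrow> real" where
  "soft_O C c d x = C * real_of_int \<lceil>x\<rceil> * ln (2 + x) ^ c * ln (2 + real d) ^ c"

end

theory Submission
  imports Defs "HOL-Analysis.L2_Norm"
begin

text \<open>Up to an arbitrarily small error, \<open>T\<close> is a nonnegative combination of cosine matrices
  \<open>cos ((p - q) \<theta>)\<close>: extend \<open>T\<close> to a large positive semidefinite Toeplitz matrix and discretise
  the Fejer mean of its symbol. Group the frequencies into buckets of width \<open>1 / d\<close>, and let \<open>H\<close>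
  be the \<open>n\<close> buckets of largest mass, \<open>\<alpha>\<close> being an upper bound for the mass of the others. By
  Schur's test the light part has operator norm \<open>O(\<alpha> d log d)\<close>, so its squared Frobenius norm
  exceeds the best rank-\<open>k\<close> error of \<open>T\<close> by at most \<open>O(k \<alpha>\<^sup>2 d\<^sup>2 log\<^sup>2 d)\<close>. On the other hand the
  buckets in \<open>H\<close>, trimmed to mass \<open>\<alpha>\<close>, have squared Frobenius norm at least \<open>n \<alpha>\<^sup>2 d\<^sup>2 / 4\<close>, and
  no rank-\<open>k\<close> matrix can absorb them either. Hence \<open>n\<close> of order \<open>k log\<^sup>2 d / \<epsilon>\<close> buckets suffice.
  Within a bucket the Taylor expansion of the cosine in the frequency gives a symmetric Toeplitz
  approximation whose rank is twice the order \<open>m\<close>, with error \<open>2 / m!\<close>, so that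
  \<open>m = O(log (d / \<delta>))\<close> is enough.\<close>

subsection \<open>Cosine decomposition of positive semidefinite Toeplitz sequences\<close>

text \<open>The approximant must itself be Toeplitz, so truncating an eigendecomposition of
  \<open>T\<close> is no option, and a rank \<open>k\<close> matrix can only serve as a benchmark.
  What carries the argument is positivity. With nonnegative weights all Frobenius products of cosine
  matrices are nonnegative; hence norms are monotone in the weights, dropping terms gives lower
  bounds, and the energies of the light and the heavy part add up to at most the energy of the
  whole. The number of discrete frequencies is uncontrolled, but harmless: the rank counts buckets,
  never frequencies. The other obstacle is the shape of the bound, a product with
  \<open>ln (1 / \<delta>)\<close>, whereas the Taylor order is additive in \<open>ln d\<close> and
  \<open>ln (1 / \<delta>)\<close>. For \<open>\<delta> \<le> 63 / 64\<close> the factor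
  \<open>ln (1 / \<delta>)\<close> is bounded below and a constant absorbs the difference. Closer to
  1 the permitted number of buckets may be far below \<open>k\<close>, and the energies have to be
  balanced in another way.\<close>

text \<open>With truncated subtraction, \<open>(p - q) + (q - p)\<close> is the distance of \<open>p\<close> and \<open>q\<close>.\<close>

definition psd_seq :: "nat \<Rightarrow> (nat \<Rightarrow> real) \<Rightarrow> bool" where
  "psd_seq n t \<longleftrightarrow> (\<forall>v. 0 \<le> (\<Sum>p<n. \<Sum>q<n. t ((p - q) + (q - p)) * v p * v q))"

lemma psd_seqD: "psd_seq n t \<Longrightarrow> 0 \<le> (\<Sum>p<n. \<Sum>q<n. t ((p - q) + (q - p)) * v p * v q)"
  unfolding psd_seq_def by blast

text \<open>The rotation preserves \<open>v p * v q + w p * w q\<close> for all \<open>p\<close> and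
  \<open>q\<close>, hence the sum of the two values of any quadratic form.\<close>

lemma rotation_quadratic_form:
  fixes t :: "nat \<Rightarrow> real"
  assumes "c\<^sup>2 + s\<^sup>2 = 1"
  shows "(\<Sum>p<n. \<Sum>q<n. t ((p - q) + (q - p)) * (c * v p + s * w p) * (c * v q + s * w q)) +
         (\<Sum>p<n. \<Sum>q<n. t ((p - q) + (q - p)) * (c * w p - s * v p) * (c * w q - s * v q)) =
         (\<Sum>p<n. \<Sum>q<n. t ((p - q) + (q - p)) * v p * v q) +
         (\<Sum>p<n. \<Sum>q<n. t ((p - q) + (q - p)) * w p * w q)"
proof -
  have *: "x * (c * a + s * b) * (c * a' + s * b') + x * (c * b - s * a) * (c * b' - s * a')
      = x * a * a' + x * b * b'" for x a b a' b'
  proof -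
    have "x * (c * a + s * b) * (c * a' + s * b') + x * (c * b - s * a) * (c * b' - s * a')
      = (c\<^sup>2 + s\<^sup>2) * (x * a * a' + x * b * b')"
      by (simp add: algebra_simps power2_eq_square)
    then show ?thesis using assms by simp
  qed
  show ?thesis
    by (simp only: sum.distrib[symmetric] *)
qed

lemma sum_delta_delta:
  fixes m n :: nat
  assumes "a < m" "b < n"
  shows "(\<Sum>p<m. \<Sum>q<n. if p = a then if q = b then f p q else 0 else 0) = (f a b :: real)"
proof -
  have "(\<Sum>p<m. \<Sum>q<n. if p = a then if q = b then f p q else 0 else 0)
    = (\<Sum>p<m. if p = a then \<Sum>q<n. if q = b then f p q else 0 else 0)"
    by (intro sum.cong) auto
  also have "\<dots> = f a b" using assms by simp
  finally show ?thesis .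
qed

text \<open>Vectors with \<open>v 0 * v (Suc n)\<close> positive bound \<open>x\<close> from below, those with a negative product from
  above. The bounds are compatible: if the products of \<open>v\<close> and \<open>w\<close> are \<open>1\<close> and \<open>- 1\<close>, some rotation of
  the pair makes both products vanish, and there the form is one of the given size.\<close>

lemma psd_seq_extend_one:
  assumes psd: "psd_seq (Suc n) t"
  shows "\<exists>x. psd_seq (Suc (Suc n)) (t(Suc n := x))"
proof -
  define u where "u = t(Suc n := 0)"
  define R where "R v = (\<Sum>p<Suc (Suc n). \<Sum>q<Suc (Suc n). u ((p - q) + (q - p)) * v p * v q)" for v
  \<comment> \<open>One end coordinate vanishes, so the unknown corner entry is never met, and the
    others form a window of length \<open>Suc n\<close>. Shifting the window changes nothing, since
    the form depends on differences of indices only.\<close>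
  have R0: "R v \<ge> 0" if "v 0 * v (Suc n) = 0" for v
  proof (cases "v 0 = 0")
    case True
    have "R v = (\<Sum>p<Suc n. \<Sum>q<Suc n. u ((p - q) + (q - p)) * v (Suc p) * v (Suc q))"
      unfolding R_def sum.lessThan_Suc_shift[of _ "Suc n"] by (simp add: True del: sum.lessThan_Suc)
    also have "\<dots> = (\<Sum>p<Suc n. \<Sum>q<Suc n. t ((p - q) + (q - p)) * v (Suc p) * v (Suc q))"
      by (intro sum.cong refl) (auto simp: u_def)
    finally have "R v = (\<Sum>p<Suc n. \<Sum>q<Suc n. t ((p - q) + (q - p)) * v (Suc p) * v (Suc q))" .
    then show ?thesis using psd_seqD[OF psd, of "\<lambda>p. v (Suc p)"] by simp
  next
    case False
    then have 0: "v (Suc n) = 0" using that by simp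
    have "R v = (\<Sum>p<Suc n. \<Sum>q<Suc n. u ((p - q) + (q - p)) * v p * v q)"
      unfolding R_def by (simp add: 0)
    also have "\<dots> = (\<Sum>p<Suc n. \<Sum>q<Suc n. t ((p - q) + (q - p)) * v p * v q)"
      by (intro sum.cong refl) (auto simp: u_def)
    finally show ?thesis using psd_seqD[OF psd, of v] by simp
  qed
  have Rscale: "R (\<lambda>p. l * v p) = l\<^sup>2 * R v" for l v
    unfolding R_def sum_distrib_left by (intro sum.cong refl) (simp add: power2_eq_square)
  have key: "R v + R w \<ge> 0" if "v 0 * v (Suc n) = 1" "w 0 * w (Suc n) = -1" for v w
  proof -
    define r where "r = sqrt ((v 0)\<^sup>2 + (w 0)\<^sup>2)"
    have "v 0 \<noteq> 0" using that by auto
    then have r: "r > 0" "r\<^sup>2 = (v 0)\<^sup>2 + (w 0)\<^sup>2" unfolding r_def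
      by (auto simp: sum_power2_gt_zero_iff)
    \<comment> \<open>Chosen so that \<open>y 0 = 0\<close> and \<open>z 0 = r\<close>. The rotation
      also preserves the sum of the two end products, which is \<open>1 - 1 = 0\<close>, and this
      forces \<open>z (Suc n) = 0\<close>.\<close>
    define c where "c = w 0 / r"
    define s where "s = - v 0 / r"
    have cs: "c\<^sup>2 + s\<^sup>2 = 1"
      using r \<open>v 0 \<noteq> 0\<close> by (simp add: c_def s_def power_divide add_divide_distrib[symmetric] add.commute)
    define y where "y p = c * v p + s * w p" for p
    define z where "z p = c * w p - s * v p" for p
    have y0: "y 0 = 0" by (simp add: y_def c_def s_def)
    have z0: "z 0 \<noteq> 0"
    proof -
      have "z 0 * r = r\<^sup>2" using r(1) \<open>v 0 \<noteq> 0\<close> unfolding r(2) by (simp add: z_def c_def s_def add_divide_distrib[symmetric] power2_eq_square)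
      then show ?thesis using r by auto
    qed
    have "y 0 * y (Suc n) + z 0 * z (Suc n) = (c\<^sup>2 + s\<^sup>2) * (v 0 * v (Suc n) + w 0 * w (Suc n))"
      by (simp add: y_def z_def algebra_simps power2_eq_square)
    then have "z (Suc n) = 0" using y0 z0 that by simp
    moreover have "R y + R z = R v + R w"
      unfolding R_def y_def z_def by (rule rotation_quadratic_form[OF cs])
    ultimately show ?thesis using R0[of y] R0[of z] y0 by simp
  qed
  \<comment> \<open>The extended form at \<open>v\<close> is
    \<open>R v + 2 * x * (v 0 * v (Suc n))\<close>, the 2 counting the two corners that hold
    \<open>x\<close>. Solving for \<open>x\<close> gives the lower bounds \<open>A\<close> and the
    upper bounds \<open>B\<close>.\<close>
  define A where "A = {- R v / (2 * (v 0 * v (Suc n))) | v. v 0 * v (Suc n) > 0}"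
  define B where "B = {- R v / (2 * (v 0 * v (Suc n))) | v. v 0 * v (Suc n) < 0}"
  have AB: "a \<le> b" if a: "a \<in> A" and b: "b \<in> B" for a b
  proof -
    obtain v where v: "v 0 * v (Suc n) > 0" "a = - R v / (2 * (v 0 * v (Suc n)))"
      using a unfolding A_def by blast
    obtain w where w: "w 0 * w (Suc n) < 0" "b = - R w / (2 * (w 0 * w (Suc n)))"
      using b unfolding B_def by blast
    let ?l = "1 / sqrt (v 0 * v (Suc n))" and ?m = "1 / sqrt (- (w 0 * w (Suc n)))"
    have l2: "?l\<^sup>2 = 1 / (v 0 * v (Suc n))" using v by (simp add: power_divide)
    have m2: "?m\<^sup>2 = - 1 / (w 0 * w (Suc n))" using w by (simp add: power_divide)
    have "R (\<lambda>p. ?l * v p) + R (\<lambda>p. ?m * w p) \<ge> 0"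
    proof (rule key)
      have "?l * v 0 * (?l * v (Suc n)) = ?l\<^sup>2 * (v 0 * v (Suc n))"
        by (simp add: power2_eq_square)
      also have "\<dots> = 1" unfolding l2 using v(1) by auto
      finally show "?l * v 0 * (?l * v (Suc n)) = 1" .
      have "?m * w 0 * (?m * w (Suc n)) = ?m\<^sup>2 * (w 0 * w (Suc n))"
        by (simp add: power2_eq_square)
      also have "\<dots> = -1" unfolding m2 using w(1) by auto
      finally show "?m * w 0 * (?m * w (Suc n)) = - 1" .
    qed
    then have "R v / (v 0 * v (Suc n)) - R w / (w 0 * w (Suc n)) \<ge> 0"
      unfolding Rscale l2 m2 by simp
    moreover have "- r / (2 * y) = - (r / y) / 2" for r y :: real by simp
    ultimately show ?thesis unfolding v(2) w(2) by linarith
  qed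
  have AI: "- R v / (2 * (v 0 * v (Suc n))) \<in> A" if "v 0 * v (Suc n) > 0" for v
    unfolding A_def using that by (intro CollectI exI[of _ v] conjI refl)
  have BI: "- R v / (2 * (v 0 * v (Suc n))) \<in> B" if "v 0 * v (Suc n) < 0" for v
    unfolding B_def using that by (intro CollectI exI[of _ v] conjI refl)
  have Ane: "A \<noteq> {}" using AI[of "\<lambda>_. 1"] by auto
  have Bne: "B \<noteq> {}" using BI[of "\<lambda>p. if p = 0 then 1 else -1"] by auto
  then obtain b0 where b0: "b0 \<in> B" by blast
  have bdd: "bdd_above A" using AB b0 by (meson bdd_above.I)
  define x where "x = Sup A"
  have xA: "a \<le> x" if "a \<in> A" for a using that bdd unfolding x_def by (rule cSup_upper)
  have xB: "x \<le> b" if "b \<in> B" for b unfolding x_def using Ane AB that by (intro cSup_least) auto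
  have "psd_seq (Suc (Suc n)) (t(Suc n := x))"
    unfolding psd_seq_def
  proof
    fix v :: "nat \<Rightarrow> real"
    let ?\<pi> = "v 0 * v (Suc n)"
    have "(\<Sum>p<Suc (Suc n). \<Sum>q<Suc (Suc n). (t(Suc n := x)) ((p - q) + (q - p)) * v p * v q)
      = (\<Sum>p<Suc (Suc n). \<Sum>q<Suc (Suc n). u ((p - q) + (q - p)) * v p * v q
          + ((if p = 0 then if q = Suc n then x * v p * v q else 0 else 0)
            + (if p = Suc n then if q = 0 then x * v p * v q else 0 else 0)))"
      by (intro sum.cong refl) (auto simp: u_def)
    also have "\<dots> = R v + 2 * x * ?\<pi>"
      unfolding sum.distrib R_def[symmetric]
      by (subst (1 2) sum_delta_delta) (simp_all del: sum.lessThan_Suc add: mult_ac)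
    also have "\<dots> \<ge> 0"
    proof -
      have *: "0 \<le> r + 2 * x * z" if "z > 0 \<and> - r / (2 * z) \<le> x \<or> z < 0 \<and> x \<le> - r / (2 * z)" for r z
        using that by (auto simp: field_simps)
      consider "?\<pi> = 0" | "?\<pi> > 0" | "?\<pi> < 0" by linarith
      then show ?thesis
      proof cases
        case 1 then show ?thesis using R0[OF 1] by (simp only: mult_zero_right add_0_right)
      next
        case 2
        then have "- R v / (2 * ?\<pi>) \<le> x" by (intro xA AI)
        then show ?thesis using 2 by (intro *) blast
      next
        case 3
        then have "x \<le> - R v / (2 * ?\<pi>)" by (intro xB BI)
        then show ?thesis using 3 by (intro *) blast
      qed
    qed
    finally show "0 \<le> (\<Sum>p<Suc (Suc n). \<Sum>q<Suc (Suc n). (t(Suc n := x)) ((p - q) + (q - p)) * v p * v q)" .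
  qed
  then show ?thesis by blast
qed

lemma psd_seq_extend:
  assumes "psd_seq (Suc n) t" "n \<le> N"
  shows "\<exists>t'. psd_seq (Suc N) t' \<and> (\<forall>m \<le> n. t' m = t m)"
  using assms(2)
proof (induction N rule: dec_induct)
  case base then show ?case using assms(1) by blast
next
  case (step N)
  then obtain t' where "psd_seq (Suc N) t'" "\<forall>m \<le> n. t' m = t m" by blast
  moreover obtain x where "psd_seq (Suc (Suc N)) (t'(Suc N := x))"
    using psd_seq_extend_one calculation(1) by blast
  ultimately show ?case using step.hyps 
    by (intro exI[of _ "t'(Suc N := x)"] conjI) (assumption, simp)
qed

text \<open>Discrete orthogonality at the nodes of the cosine transform. Multiplication by
  \<open>2 * sin x\<close> telescopes the sum to \<open>sin (a * pi) = 0\<close>, and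
  \<open>\<bar>a\<bar> < 2 * N\<close> keeps \<open>sin x\<close> away from 0.\<close>

lemma sum_cos_midpoints:
  assumes "N > 0" "0 < \<bar>a\<bar>" "\<bar>a\<bar> < 2 * int N"
  shows "(\<Sum>j<N. cos (real_of_int a * (real (2 * j + 1) * pi / real (2 * N)))) = 0"
proof -
  define x where "x = real_of_int a * pi / real (2 * N)"
  have tel: "2 * sin x * (\<Sum>j<n. cos (real (2 * j + 1) * x)) = sin (2 * real n * x)" for n
  proof (induction n)
    case (Suc n)
    have "2 * sin x * cos (real (2 * n + 1) * x) = sin (2 * real (Suc n) * x) - sin (2 * real n * x)"
      using sin_times_cos[of x "real (2 * n + 1) * x"] sin_minus[of "2 * real n * x"] by (simp add: algebra_simps)
    then show ?case using Suc by (simp add: algebra_simps)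
  qed simp
  have "sin x \<noteq> 0"
  proof
    assume "sin x = 0"
    then obtain i where "x = of_int i * pi" using sin_zero_iff_int2 by blast
    then have "real_of_int a = real_of_int i * real (2 * N)"
      using assms(1) by (simp add: x_def field_simps)
    then have "a = i * (2 * int N)" 
      by (simp only: of_int_eq_iff[where ?'a = real, symmetric]) simp
    moreover from this have "i \<noteq> 0" using assms(2) by auto
    then have "1 * (2 * int N) \<le> \<bar>i\<bar> * (2 * int N)" by (intro mult_right_mono) auto
    ultimately show False using assms(3) by (simp add: abs_mult)
  qed
  moreover have "sin (2 * real N * x) = 0"
  proof -
    have "2 * real N * x = real_of_int a * pi" using assms(1) by (simp add: x_def)
    then show ?thesis using sin_zero_iff_int2 by blast
  qed
  ultimately have "(\<Sum>j<N. cos (real (2 * j + 1) * x)) = 0" using tel[of N] by simp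
  moreover have "real_of_int a * (real (2 * j + 1) * pi / real (2 * N)) = real (2 * j + 1) * x" for j
    by (simp add: x_def)
  ultimately show ?thesis by simp
qed

text \<open>This count, divided by \<open>N\<close>, is the triangular Fejer weight.\<close>

lemma card_offset_pairs:
  assumes "m < N"
  shows "(\<Sum>p<N. \<Sum>q<N. if int p - int q = int m then 1 else 0) = real N - real m"
proof -
  have "(\<Sum>p<N. \<Sum>q<N. if int p - int q = int m then 1 else (0::real)) = (\<Sum>p<N. if m \<le> p then 1 else 0)"
  proof (intro sum.cong refl)
    fix p assume "p \<in> {..<N}"
    then have "(\<Sum>q<N. if int p - int q = int m then 1 else (0::real)) = (\<Sum>q<N. if q = p - m then if m \<le> p then 1 else 0 else 0)"
      by (intro sum.cong refl) auto
    also have "\<dots> = (if m \<le> p then 1 else 0)" using \<open>p \<in> {..<N}\<close> by (auto simp: sum.delta)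
    finally show "(\<Sum>q<N. if int p - int q = int m then 1 else (0::real)) = (if m \<le> p then 1 else 0)" .
  qed
  also have "\<dots> = real (card {p. p < N \<and> m \<le> p})" by (simp add: sum.If_cases Int_def)
  also have "{p. p < N \<and> m \<le> p} = {m..<N}" by auto
  finally show ?thesis using assms by simp
qed

text \<open>The weight at a node is, up to scaling, the quadratic form at the complex exponential of
  that frequency, split into its cosine and sine vectors; so it is nonnegative. The quadrature is
  exact because all frequencies \<open>p - q - m\<close> and \<open>q - p - m\<close> that occur are
  below \<open>2 * N\<close> in modulus.\<close>

lemma fejer_quadrature:
  assumes "N > 0" "psd_seq N t"
  shows "\<exists>c. (\<forall>j. 0 \<le> c j) \<and>
    (\<forall>m<N. (\<Sum>j<N. c j * cos (real m * (real (2 * j + 1) * pi / real (2 * N)))) = t m * (1 - real m / real N))"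
proof -
  define \<theta> where "\<theta> j = real (2 * j + 1) * pi / real (2 * N)" for j
  define c where "c j = (\<Sum>p<N. \<Sum>q<N. t ((p - q) + (q - p)) * cos (of_int (int p - int q) * \<theta> j)) / (real N)\<^sup>2" for j
  have cpos: "c j \<ge> 0" for j
  proof -
    have "(\<Sum>p<N. \<Sum>q<N. t ((p - q) + (q - p)) * cos (of_int (int p - int q) * \<theta> j)) =
      (\<Sum>p<N. \<Sum>q<N. t ((p - q) + (q - p)) * cos (real p * \<theta> j) * cos (real q * \<theta> j)) +
      (\<Sum>p<N. \<Sum>q<N. t ((p - q) + (q - p)) * sin (real p * \<theta> j) * sin (real q * \<theta> j))"
      unfolding sum.distrib[symmetric]
      by (intro sum.cong refl) (simp add: cos_diff left_diff_distrib algebra_simps)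
    also have "\<dots> \<ge> 0" by (intro add_nonneg_nonneg psd_seqD[OF assms(2)])
    finally show ?thesis unfolding c_def by simp
  qed
  have orth: "(\<Sum>j<N. cos (of_int a * \<theta> j)) = (if a = 0 then real N else 0)" if "\<bar>a\<bar> < 2 * int N" for a
    using sum_cos_midpoints[OF assms(1), of a] that unfolding \<theta>_def by auto
  have "(\<Sum>j<N. c j * cos (real m * \<theta> j)) = t m * (1 - real m / real N)" if m: "m < N" for m
  proof -
    have eq: "(\<Sum>j<N. cos (of_int (int p - int q) * \<theta> j) * cos (real m * \<theta> j)) =
      real N / 2 * ((if int p - int q = int m then 1 else 0) + (if int q - int p = int m then 1 else 0))"
      if "p < N" "q < N" for p q
    proof -
      have "(\<Sum>j<N. cos (of_int (int p - int q) * \<theta> j) * cos (real m * \<theta> j)) =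
        (\<Sum>j<N. cos (of_int (int p - int q - int m) * \<theta> j)) / 2 + (\<Sum>j<N. cos (of_int (int q - int p - int m) * \<theta> j)) / 2"
        unfolding sum_divide_distrib sum.distrib[symmetric]
      proof (intro sum.cong refl)
        fix j
        have "cos (of_int (int q - int p - int m) * \<theta> j) = cos (of_int (int p - int q) * \<theta> j + real m * \<theta> j)"
          by (subst cos_minus[symmetric]) (simp add: algebra_simps)
        then show "cos (of_int (int p - int q) * \<theta> j) * cos (real m * \<theta> j) =
          cos (of_int (int p - int q - int m) * \<theta> j) / 2 + cos (of_int (int q - int p - int m) * \<theta> j) / 2"
          by (simp add: cos_times_cos left_diff_distrib add_divide_distrib)
      qed
      also have "\<dots> = (if int p - int q - int m = 0 then real N else 0) / 2 + (if int q - int p - int m = 0 then real N else 0) / 2"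
        using that m by (subst (1 2) orth) auto
      finally show ?thesis by auto
    qed
    have "(\<Sum>j<N. c j * cos (real m * \<theta> j)) = (\<Sum>j<N. \<Sum>p<N. \<Sum>q<N. t ((p - q) + (q - p)) * (cos (of_int (int p - int q) * \<theta> j) * cos (real m * \<theta> j))) / (real N)\<^sup>2"
      unfolding c_def by (simp add: sum_distrib_left sum_distrib_right sum_divide_distrib mult_ac)
    also have "(\<Sum>j<N. \<Sum>p<N. \<Sum>q<N. t ((p - q) + (q - p)) * (cos (of_int (int p - int q) * \<theta> j) * cos (real m * \<theta> j))) =
       (\<Sum>p<N. \<Sum>j<N. \<Sum>q<N. t ((p - q) + (q - p)) * (cos (of_int (int p - int q) * \<theta> j) * cos (real m * \<theta> j)))"
      by (rule sum.swap)
    also have "\<dots> = (\<Sum>p<N. \<Sum>q<N. \<Sum>j<N. t ((p - q) + (q - p)) * (cos (of_int (int p - int q) * \<theta> j) * cos (real m * \<theta> j)))"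
      by (intro sum.cong refl sum.swap)
    also have "\<dots> = (\<Sum>p<N. \<Sum>q<N. t ((p - q) + (q - p)) * (real N / 2 * ((if int p - int q = int m then 1 else 0) + (if int q - int p = int m then 1 else 0))))"
      by (intro sum.cong refl) (simp only: sum_distrib_left[symmetric] eq lessThan_iff)
    also have "\<dots> = (\<Sum>p<N. \<Sum>q<N. t m * real N / 2 * ((if int p - int q = int m then 1 else 0) + (if int q - int p = int m then 1 else 0)))"
    proof (intro sum.cong refl)
      fix p q
      have "(p - q) + (q - p) = m" if "int p - int q = int m \<or> int q - int p = int m" using that by auto
      then have "t ((p - q) + (q - p)) = t m" if "int p - int q = int m \<or> int q - int p = int m" using that by metis
      then show "t ((p - q) + (q - p)) * (real N / 2 * ((if int p - int q = int m then 1 else 0) + (if int q - int p = int m then 1 else 0))) =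
        t m * real N / 2 * ((if int p - int q = int m then 1 else 0) + (if int q - int p = int m then 1 else 0))"
        by (cases "int p - int q = int m \<or> int q - int p = int m") (simp, simp)
    qed
    also have "\<dots> = t m * real N / 2 * ((\<Sum>p<N. \<Sum>q<N. if int p - int q = int m then 1 else 0) + (\<Sum>q<N. \<Sum>p<N. if int q - int p = int m then 1 else 0))"
      unfolding sum_distrib_left[symmetric] sum.distrib
      by (subst (3) sum.swap) simp
    also have "\<dots> = t m * real N * (real N - real m)"
      unfolding card_offset_pairs[OF m] by simp
    also have "\<dots> / (real N)\<^sup>2 = t m * (1 - real m / real N)"
      using assms(1) by (simp add: field_simps power2_eq_square)
    finally show ?thesis .
  qed
  then show ?thesis using cpos unfolding \<theta>_def by (intro exI[of _ c]) blast
qed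

text \<open>Extending \<open>t\<close> to a length \<open>N\<close> above \<open>d / \<tau>\<close>
  before averaging brings the Fejer factors \<open>1 - m / N\<close> within \<open>\<tau>\<close> of
  1 for all \<open>m < d\<close>. The error is stated as a factor in [0, 1] because this yields
  closeness to \<open>T\<close> and also that no entry grows.\<close>

lemma psd_seq_cosine_approx:
  assumes "psd_seq d t" "d > 0" "\<tau> > 0"
  shows "\<exists>N c \<theta>. (\<forall>j<N::nat. 0 \<le> c j \<and> 0 \<le> \<theta> j \<and> \<theta> j \<le> pi) \<and>
    (\<forall>m<d. \<exists>r. 0 \<le> r \<and> r \<le> \<tau> \<and> r \<le> 1 \<and> (\<Sum>j<N. c j * cos (real m * \<theta> j)) = t m * (1 - r)) \<and>
    (\<Sum>j<N. c j) = t 0"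
proof -
  obtain n where n: "d = Suc n" using assms(2) by (cases d) auto
  obtain M where M: "real M > real d / \<tau>" using reals_Archimedean2 by blast
  define N where "N = Suc (M + d)"
  obtain t' where t': "psd_seq N t'" "\<forall>m \<le> n. t' m = t m"
    using psd_seq_extend[of n t "M + d"] assms n unfolding N_def by auto
  have N: "N > 0" "d < N" "real d / real N \<le> \<tau>"
    using M assms(3) by (auto simp: N_def field_simps add_pos_pos intro: order.trans less_imp_le)
  obtain c where c: "\<forall>j. 0 \<le> c j"
    "\<forall>m<N. (\<Sum>j<N. c j * cos (real m * (real (2 * j + 1) * pi / real (2 * N)))) = t' m * (1 - real m / real N)"
    using fejer_quadrature[OF N(1) t'(1)] by blast
  show ?thesis
  proof (intro exI conjI allI impI)
    fix j assume j: "j < N"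
    show "0 \<le> c j" using c by simp
    show "0 \<le> real (2 * j + 1) * pi / real (2 * N)" by simp
    have "real (2 * j + 1) \<le> real (2 * N)" using j by (intro of_nat_mono) linarith
    then show "real (2 * j + 1) * pi / real (2 * N) \<le> pi" using N
      by (simp add: divide_le_eq)
  next
    fix m assume m: "m < d"
    show "0 \<le> real m / real N" by simp
    have "real m / real N \<le> real d / real N" using m by (intro divide_right_mono) auto
    then show "real m / real N \<le> \<tau>" using N by linarith
    show "real m / real N \<le> 1" using m N by simp
    show "(\<Sum>j<N. c j * cos (real m * (real (2 * j + 1) * pi / real (2 * N)))) = t m * (1 - real m / real N)"
      using c(2) m N(2) t'(2) n by simp
  next
    show "sum c {..<N} = t 0" using c(2) N(1) t'(2) by auto
  qed
qed

subsection \<open>Gram matrices and low-rank residuals\<close>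

definition ip :: "nat \<Rightarrow> (nat \<Rightarrow> real) \<Rightarrow> (nat \<Rightarrow> real) \<Rightarrow> real" where
  "ip d u v = (\<Sum>p<d. u p * v p)"

definition fro2 :: "nat \<Rightarrow> (nat \<Rightarrow> nat \<Rightarrow> real) \<Rightarrow> real" where
  "fro2 d M = (\<Sum>p<d. \<Sum>q<d. (M p q)\<^sup>2)"

text \<open>A sum of weighted outer products, the partner of the matrix of the inner products
  \<open>ip d (w i) (w j)\<close>; norms are computed from the latter.\<close>

definition gram :: "'i set \<Rightarrow> ('i \<Rightarrow> real) \<Rightarrow> ('i \<Rightarrow> nat \<Rightarrow> real) \<Rightarrow> nat \<Rightarrow> nat \<Rightarrow> real" where
  "gram I c w p q = (\<Sum>i\<in>I. c i * w i p * w i q)"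

definition mv :: "nat \<Rightarrow> (nat \<Rightarrow> nat \<Rightarrow> real) \<Rightarrow> (nat \<Rightarrow> real) \<Rightarrow> nat \<Rightarrow> real" where
  "mv d M v p = (\<Sum>q<d. M p q * v q)"

lemma ip_commute: "ip d u v = ip d v u"
  by (simp add: ip_def mult.commute)

lemma ip_self_nonneg: "0 \<le> ip d u u"
  by (simp add: ip_def sum_nonneg)

lemma ip_self_eq_0: "ip d u u = 0 \<Longrightarrow> p < d \<Longrightarrow> u p = 0"
  by (simp add: ip_def sum_nonneg_eq_0_iff)

lemma ip_cauchy_schwarz: "(ip d u v)\<^sup>2 \<le> ip d u u * ip d v v"
proof -
  \<comment> \<open>Lagrange's identity: this sum is twice the difference of the two sides of the
    claim.\<close>
  have "0 \<le> (\<Sum>p<d. \<Sum>q<d. (u p * v q - u q * v p)\<^sup>2)" by (intro sum_nonneg) auto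
  also have "\<dots> = (\<Sum>p<d. \<Sum>q<d. (u p * u p) * (v q * v q)) + (\<Sum>p<d. \<Sum>q<d. (u q * u q) * (v p * v p))
      - 2 * (\<Sum>p<d. \<Sum>q<d. (u p * v p) * (u q * v q))"
    unfolding sum_distrib_left sum.distrib[symmetric] sum_subtractf[symmetric]
    by (intro sum.cong refl) (simp add: power2_eq_square algebra_simps)
  also have "(\<Sum>p<d. \<Sum>q<d. (u q * u q) * (v p * v p)) = (\<Sum>p<d. \<Sum>q<d. (u p * u p) * (v q * v q))"
    by (rule sum.swap)
  finally show ?thesis unfolding ip_def power2_eq_square sum_product by linarith
qed

lemma ip_sum_left: "ip d (\<lambda>p. \<Sum>i\<in>I. c i * w i p) v = (\<Sum>i\<in>I. c i * ip d (w i) v)"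
proof -
  have "ip d (\<lambda>p. \<Sum>i\<in>I. c i * w i p) v = (\<Sum>p<d. \<Sum>i\<in>I. c i * (w i p * v p))"
    unfolding ip_def sum_distrib_right by (simp only: mult.assoc)
  also have "\<dots> = (\<Sum>i\<in>I. c i * ip d (w i) v)"
    unfolding ip_def sum_distrib_left by (rule sum.swap)
  finally show ?thesis .
qed

lemma ip_sum_right: "ip d v (\<lambda>p. \<Sum>i\<in>I. c i * w i p) = (\<Sum>i\<in>I. c i * ip d v (w i))"
  using ip_sum_left[of d c w I v] by (simp add: ip_commute)

lemma ip_diff_left: "ip d (\<lambda>p. u p - w p) v = ip d u v - ip d w v"
  by (simp add: ip_def left_diff_distrib sum_subtractf)

lemma ip_diff_right: "ip d v (\<lambda>p. u p - w p) = ip d v u - ip d v w"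
  by (simp add: ip_def right_diff_distrib sum_subtractf)

lemma fro2_nonneg: "0 \<le> fro2 d M"
  by (simp add: fro2_def sum_nonneg)

lemma mv_gram: "mv d (gram I c w) v = (\<lambda>p. \<Sum>i\<in>I. (c i * ip d (w i) v) * w i p)"
proof
  fix p
  have "mv d (gram I c w) v p = (\<Sum>q<d. \<Sum>i\<in>I. c i * w i p * w i q * v q)"
    by (simp add: mv_def gram_def sum_distrib_right)
  also have "\<dots> = (\<Sum>i\<in>I. \<Sum>q<d. c i * w i p * w i q * v q)" by (rule sum.swap)
  also have "\<dots> = (\<Sum>i\<in>I. (c i * ip d (w i) v) * w i p)"
    by (simp add: ip_def sum_distrib_left sum_distrib_right mult_ac)
  finally show "mv d (gram I c w) v p = (\<Sum>i\<in>I. (c i * ip d (w i) v) * w i p)" .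
qed

lemma gram_inner_product:
  "(\<Sum>p<d. \<Sum>q<d. gram I a w p q * gram J b y p q) = (\<Sum>i\<in>I. \<Sum>j\<in>J. a i * b j * (ip d (w i) (y j))\<^sup>2)"
proof -
  have "(\<Sum>p<d. \<Sum>q<d. gram I a w p q * gram J b y p q) =
    (\<Sum>p<d. \<Sum>q<d. \<Sum>i\<in>I. \<Sum>j\<in>J. a i * b j * ((w i p * y j p) * (w i q * y j q)))"
    unfolding gram_def sum_product by (simp only: mult_ac)
  also have "\<dots> = (\<Sum>p<d. \<Sum>i\<in>I. \<Sum>q<d. \<Sum>j\<in>J. a i * b j * ((w i p * y j p) * (w i q * y j q)))"
    by (rule sum.cong[OF refl], rule sum.swap)
  also have "\<dots> = (\<Sum>i\<in>I. \<Sum>p<d. \<Sum>q<d. \<Sum>j\<in>J. a i * b j * ((w i p * y j p) * (w i q * y j q)))"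
    by (rule sum.swap)
  also have "\<dots> = (\<Sum>i\<in>I. \<Sum>p<d. \<Sum>j\<in>J. \<Sum>q<d. a i * b j * ((w i p * y j p) * (w i q * y j q)))"
    by (rule sum.cong[OF refl], rule sum.cong[OF refl], rule sum.swap)
  also have "\<dots> = (\<Sum>i\<in>I. \<Sum>j\<in>J. \<Sum>p<d. \<Sum>q<d. a i * b j * ((w i p * y j p) * (w i q * y j q)))"
    by (rule sum.cong[OF refl], rule sum.swap)
  also have "\<dots> = (\<Sum>i\<in>I. \<Sum>j\<in>J. a i * b j * (ip d (w i) (y j))\<^sup>2)"
    by (simp only: ip_def power2_eq_square sum_product) (simp only: sum_distrib_left)
  finally show ?thesis .
qed

lemma fro2_gram: "fro2 d (gram I a w) = (\<Sum>i\<in>I. \<Sum>j\<in>I. a i * a j * (ip d (w i) (w j))\<^sup>2)"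
  unfolding gram_inner_product[symmetric] by (simp add: fro2_def power2_eq_square)

text \<open>By \<open>fro2_gram\<close> the products of weights are multiplied by squares. This
  elementary monotonicity stands in for the order of positive semidefinite matrices.\<close>

lemma fro2_gram_mono:
  assumes "\<And>i. i \<in> I \<Longrightarrow> 0 \<le> a i" "\<And>i. i \<in> I \<Longrightarrow> a i \<le> c i"
  shows "fro2 d (gram I a w) \<le> fro2 d (gram I c w)"
  unfolding fro2_gram using assms by (intro sum_mono mult_right_mono mult_mono) (auto intro: order_trans)

text \<open>Schur's test, applied to the Gram matrix of the \<open>w i\<close>, which has the same nonzero
  spectrum.\<close>

lemma gram_operator_bound:
  assumes a: "\<And>i. i \<in> I \<Longrightarrow> 0 \<le> a i"
    and \<mu>: "\<And>i. i \<in> I \<Longrightarrow> (\<Sum>j\<in>I. a j * \<bar>ip d (w i) (w j)\<bar>) \<le> \<mu>"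
  shows "ip d (mv d (gram I a w) v) (mv d (gram I a w) v) \<le> \<mu>\<^sup>2 * ip d v v"
proof -
  define z where "z i = ip d (w i) v" for i
  define y where "y = mv d (gram I a w) v"
  define s where "s = (\<Sum>i\<in>I. a i * (z i)\<^sup>2)"
  have y: "y = (\<lambda>p. \<Sum>i\<in>I. (a i * z i) * w i p)" by (simp add: y_def mv_gram z_def)
  have s: "ip d v y = s"
    unfolding y ip_sum_right s_def by (simp add: z_def ip_commute power2_eq_square mult_ac)
  have "ip d y y = (\<Sum>i\<in>I. \<Sum>j\<in>I. a i * a j * (z i * z j * ip d (w i) (w j)))"
  proof -
    have "ip d y y = (\<Sum>i\<in>I. (a i * z i) * (\<Sum>j\<in>I. (a j * z j) * ip d (w i) (w j)))"
      unfolding y by (simp only: ip_sum_left, simp only: ip_sum_right)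
    then show ?thesis by (simp add: sum_distrib_left mult_ac)
  qed
  \<comment> \<open>The inequality of the means separates \<open>z i\<close> from
    \<open>z j\<close>; by symmetry of \<open>ip\<close> the two halves are then equal.\<close>
  also have "\<dots> \<le> (\<Sum>i\<in>I. \<Sum>j\<in>I. a i * a j * (((z i)\<^sup>2 / 2 + (z j)\<^sup>2 / 2) * \<bar>ip d (w i) (w j)\<bar>))"
  proof (intro sum_mono mult_left_mono)
    fix i j assume "i \<in> I" "j \<in> I"
    have "\<bar>z i * z j\<bar> \<le> (z i)\<^sup>2 / 2 + (z j)\<^sup>2 / 2"
      using sum_squares_bound[of "\<bar>z i\<bar>" "\<bar>z j\<bar>"] by (simp add: abs_mult)
    then have "\<bar>z i * z j\<bar> * \<bar>ip d (w i) (w j)\<bar> \<le> ((z i)\<^sup>2 / 2 + (z j)\<^sup>2 / 2) * \<bar>ip d (w i) (w j)\<bar>"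
      by (rule mult_right_mono) simp
    then show "z i * z j * ip d (w i) (w j) \<le> ((z i)\<^sup>2 / 2 + (z j)\<^sup>2 / 2) * \<bar>ip d (w i) (w j)\<bar>"
      using abs_ge_self[of "z i * z j * ip d (w i) (w j)"] by (simp add: abs_mult)
  qed (use a in auto)
  also have "\<dots> = (\<Sum>i\<in>I. \<Sum>j\<in>I. a i * a j * ((z i)\<^sup>2 / 2) * \<bar>ip d (w i) (w j)\<bar>)
      + (\<Sum>i\<in>I. \<Sum>j\<in>I. a i * a j * ((z j)\<^sup>2 / 2) * \<bar>ip d (w i) (w j)\<bar>)"
    unfolding sum.distrib[symmetric] by (intro sum.cong refl) (simp add: algebra_simps)
  also have "(\<Sum>i\<in>I. \<Sum>j\<in>I. a i * a j * ((z j)\<^sup>2 / 2) * \<bar>ip d (w i) (w j)\<bar>)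
      = (\<Sum>i\<in>I. \<Sum>j\<in>I. a i * a j * ((z i)\<^sup>2 / 2) * \<bar>ip d (w i) (w j)\<bar>)"
    by (subst sum.swap) (simp add: ip_commute mult_ac)
  also have "(\<Sum>i\<in>I. \<Sum>j\<in>I. a i * a j * ((z i)\<^sup>2 / 2) * \<bar>ip d (w i) (w j)\<bar>) + \<dots>
      = (\<Sum>i\<in>I. a i * (z i)\<^sup>2 * (\<Sum>j\<in>I. a j * \<bar>ip d (w i) (w j)\<bar>))"
    unfolding sum_distrib_left sum.distrib[symmetric] by (intro sum.cong refl) (simp add: algebra_simps)
  also have "\<dots> \<le> (\<Sum>i\<in>I. a i * (z i)\<^sup>2 * \<mu>)"
    using a \<mu> by (intro sum_mono mult_left_mono) auto
  also have "\<dots> = \<mu> * s" by (simp add: s_def sum_distrib_left mult_ac)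
  finally have 1: "ip d y y \<le> \<mu> * s" .
  \<comment> \<open>As \<open>s = ip d v y\<close>, Cauchy-Schwarz bounds the right-hand side by a
    multiple of \<open>ip d y y\<close>, which is then cancelled.\<close>
  have "(ip d y y)\<^sup>2 \<le> (\<mu> * s)\<^sup>2" using 1 ip_self_nonneg by (intro power_mono)
  also have "\<dots> \<le> \<mu>\<^sup>2 * (ip d v v * ip d y y)"
    using ip_cauchy_schwarz[of d v y] unfolding s power_mult_distrib by (intro mult_left_mono) auto
  finally have 2: "ip d y y * ip d y y \<le> (\<mu>\<^sup>2 * ip d v v) * ip d y y"
    by (simp add: power2_eq_square mult_ac)
  show ?thesis
  proof (cases "ip d y y = 0")
    case True then show ?thesis using ip_self_nonneg[of d v] by (simp add: y_def)
  next
    case False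
    then have "ip d y y > 0" using ip_self_nonneg[of d y] by simp
    then show ?thesis using 2 by (simp add: y_def)
  qed
qed

section \<open>Orthogonal projections\<close>

text \<open>Zero vectors are allowed, so that a family of any length can be orthonormalised without
  changing its length.\<close>

definition orthofam :: "nat \<Rightarrow> nat \<Rightarrow> (nat \<Rightarrow> nat \<Rightarrow> real) \<Rightarrow> bool" where
  "orthofam d k E \<longleftrightarrow> (\<forall>i<k. \<forall>j<k. i \<noteq> j \<longrightarrow> ip d (E i) (E j) = 0) \<and>
     (\<forall>i<k. ip d (E i) (E i) = 0 \<or> ip d (E i) (E i) = 1)"

text \<open>The projection onto the orthogonal complement of the family, not onto its span.\<close>

definition proj :: "nat \<Rightarrow> nat \<Rightarrow> (nat \<Rightarrow> nat \<Rightarrow> real) \<Rightarrow> (nat \<Rightarrow> real) \<Rightarrow> nat \<Rightarrow> real" where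
  "proj d k E v p = v p - (\<Sum>j<k. ip d (E j) v * E j p)"

lemma ip_zero_left:
  assumes "ip d u u = 0"
  shows "ip d u v = 0"
  unfolding ip_def using ip_self_eq_0[OF assms] by (intro sum.neutral) auto

lemma orthofam_sum:
  assumes "orthofam d k E" "i < k"
  shows "(\<Sum>j<k. ip d (E j) v * ip d (E i) (E j)) = ip d (E i) v"
proof -
  have "(\<Sum>j<k. ip d (E j) v * ip d (E i) (E j)) = (\<Sum>j<k. if j = i then ip d (E i) v * ip d (E i) (E i) else 0)"
    using assms by (intro sum.cong refl) (auto simp: orthofam_def)
  also have "\<dots> = ip d (E i) v * ip d (E i) (E i)" using assms by simp
  also have "\<dots> = ip d (E i) v" using assms ip_zero_left[of d "E i" v] by (auto simp: orthofam_def)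
  finally show ?thesis .
qed

lemma ip_proj:
  assumes "orthofam d k E" "i < k"
  shows "ip d (E i) (proj d k E v) = 0"
  unfolding proj_def[abs_def] ip_diff_right ip_sum_right orthofam_sum[OF assms] by simp

lemma ip_proj_self:
  assumes "orthofam d k E"
  shows "ip d (proj d k E v) (proj d k E v) = ip d v v - (\<Sum>j<k. (ip d (E j) v)\<^sup>2)"
proof -
  have "ip d (proj d k E v) (proj d k E v) = ip d v (proj d k E v)"
    by (subst (1) proj_def[abs_def]) (simp add: ip_diff_left ip_sum_left ip_proj[OF assms])
  also have "\<dots> = ip d v v - (\<Sum>j<k. (ip d (E j) v)\<^sup>2)"
    unfolding proj_def[abs_def] ip_diff_right ip_sum_right by (simp add: power2_eq_square ip_commute)
  finally show ?thesis .
qed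

lemma ip_proj_le:
  assumes "orthofam d k E"
  shows "ip d (proj d k E v) (proj d k E v) \<le> ip d v v"
  unfolding ip_proj_self[OF assms] by (simp add: sum_nonneg)

lemma proj_sum: "proj d k E (\<lambda>p. \<Sum>i\<in>I. c i * w i p) = (\<lambda>p. \<Sum>i\<in>I. c i * proj d k E (w i) p)"
proof
  fix p
  have "(\<Sum>j<k. (\<Sum>i\<in>I. c i * ip d (E j) (w i)) * E j p) = (\<Sum>j<k. \<Sum>i\<in>I. c i * (ip d (E j) (w i) * E j p))"
    unfolding sum_distrib_right by (simp only: mult.assoc)
  also have "\<dots> = (\<Sum>i\<in>I. c i * (\<Sum>j<k. ip d (E j) (w i) * E j p))"
    unfolding sum_distrib_left by (rule sum.swap)
  finally show "proj d k E (\<lambda>p. \<Sum>i\<in>I. c i * w i p) p = (\<Sum>i\<in>I. c i * proj d k E (w i) p)"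
    unfolding proj_def ip_sum_right by (simp add: right_diff_distrib sum_subtractf)
qed

lemma proj_self:
  assumes "orthofam d k E" "i < k" "p < d"
  shows "proj d k E (E i) p = 0"
proof -
  have "ip d (proj d k E (E i)) (proj d k E (E i)) = ip d (E i) (E i) - (\<Sum>j<k. ip d (E j) (E i) * ip d (E i) (E j))"
    unfolding ip_proj_self[OF assms(1)] by (simp add: power2_eq_square ip_commute)
  also have "\<dots> = 0" unfolding orthofam_sum[OF assms(1,2)] by simp
  finally show ?thesis using ip_self_eq_0 assms(3) by blast
qed

lemma proj_cong: "(\<And>p. p < d \<Longrightarrow> u p = v p) \<Longrightarrow> p < d \<Longrightarrow> proj d k E u p = proj d k E v p"
  by (simp add: proj_def ip_def)

lemma orthonormalize:
  "\<exists>E. orthofam d k E \<and> (\<forall>i<k. \<exists>c. \<forall>p<d. U i p = (\<Sum>j<k. c j * E j p))"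
proof (induction k)
  case 0 then show ?case by (simp add: orthofam_def)
next
  case (Suc k)
  then obtain E where E: "orthofam d k E" "\<forall>i<k. \<exists>c. \<forall>p<d. U i p = (\<Sum>j<k. c j * E j p)" by blast
  define r where "r = proj d k E (U k)"
  define n where "n = sqrt (ip d r r)"
  \<comment> \<open>Gram-Schmidt. If the residual vanishes, then \<open>n = 0\<close> and division
    by zero yields the zero vector, which \<open>orthofam\<close> admits.\<close>
  define F where "F = E(k := (\<lambda>p. r p / n))"
  have n2: "n * n = ip d r r" using ip_self_nonneg by (simp add: n_def)
  have Fk: "ip d v (F k) = ip d v r / n" for v by (simp add: F_def ip_def sum_divide_distrib)
  have "ip d (F k) (F k) = ip d r r / (n * n)" by (simp add: F_def ip_def sum_divide_distrib)
  then have Fkk: "ip d (F k) (F k) = 0 \<or> ip d (F k) (F k) = 1" unfolding n2 by (cases "ip d r r = 0") auto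
  have "orthofam d (Suc k) F"
    unfolding orthofam_def
  proof (intro conjI allI impI)
    fix i j assume *: "i < Suc k" "j < Suc k" "i \<noteq> j"
    have z: "ip d (E i) (F k) = 0" if "i < k" for i
      unfolding Fk using ip_proj[OF E(1) that] by (simp add: r_def)
    show "ip d (F i) (F j) = 0"
    proof (cases "i = k")
      case True then show ?thesis using z[of j] * by (simp add: F_def ip_commute)
    next
      case False
      show ?thesis
      proof (cases "j = k")
        case True then show ?thesis using z[of i] * False by (simp add: F_def)
      next
        case j: False then show ?thesis using * False E(1) by (simp add: F_def orthofam_def)
      qed
    qed
  next
    fix i assume "i < Suc k"
    then show "ip d (F i) (F i) = 0 \<or> ip d (F i) (F i) = 1"
      using Fkk E(1) by (cases "i = k") (auto simp: F_def orthofam_def)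
  qed
  moreover have "\<exists>c. \<forall>p<d. U i p = (\<Sum>j<Suc k. c j * F j p)" if "i < Suc k" for i
  proof (cases "i = k")
    case True
    have "U k p = (\<Sum>j<k. ip d (E j) (U k) * E j p) + n * F k p" if "p < d" for p
    proof -
      have "n * F k p = r p"
      proof (cases "n = 0")
        case True
        then have "ip d r r = 0" using n2 by simp
        then show ?thesis using True ip_self_eq_0[OF _ that] by simp
      qed (simp add: F_def)
      then show ?thesis by (simp add: r_def proj_def)
    qed
    then show ?thesis unfolding True
      by (intro exI[of _ "\<lambda>j. if j = k then n else ip d (E j) (U k)"]) (simp add: F_def)
  next
    case False
    then have "i < k" using that by simp
    then obtain c where "\<forall>p<d. U i p = (\<Sum>j<k. c j * E j p)" using E(2) by blast
    then show ?thesis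
      by (intro exI[of _ "c(k := 0)"]) (simp add: F_def)
  qed
  ultimately show ?case by blast
qed

text \<open>With \<open>Q\<close> the projection off the range of \<open>B\<close>, both sides are compared with the norm of
  \<open>Q X Q\<close>: compressing \<open>X\<close> loses at most \<open>2 k \<mu>\<^sup>2\<close>, and \<open>Q X Q \<le> Q T Q = Q (T - B) Q\<close>.\<close>

lemma fro2_le_low_rank_residual:
  assumes a: "\<And>i. i \<in> I \<Longrightarrow> 0 \<le> a i" "\<And>i. i \<in> I \<Longrightarrow> a i \<le> c i"
    and B: "\<And>p q. p < d \<Longrightarrow> q < d \<Longrightarrow> B p q = (\<Sum>i<k. U i p * V i q)"
    and \<mu>: "\<And>v. ip d (mv d (gram I a w) v) (mv d (gram I a w) v) \<le> \<mu>\<^sup>2 * ip d v v"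
  shows "fro2 d (gram I a w) \<le> fro2 d (\<lambda>p q. gram I c w p q - B p q) + 2 * real k * \<mu>\<^sup>2"
proof -
  obtain E where E: "orthofam d k E" and U: "\<forall>i<k. \<exists>e. \<forall>p<d. U i p = (\<Sum>j<k. e j * E j p)"
    using orthonormalize by blast
  define y where "y i = proj d k E (w i)" for i
  have QU: "proj d k E (U i) p = 0" if i: "i < k" and p: "p < d" for i p
  proof -
    obtain e where "\<forall>p<d. U i p = (\<Sum>j<k. e j * E j p)" using U i by blast
    then have "proj d k E (U i) p = proj d k E (\<lambda>p. \<Sum>j<k. e j * E j p) p"
      using p by (intro proj_cong) auto
    also have "\<dots> = 0" unfolding proj_sum using proj_self[OF E _ p] by simp
    finally show ?thesis .
  qed
  define col where "col b q = (\<lambda>p. gram I b w p q)" for b q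
  define row where "row b p = (\<lambda>q. \<Sum>i\<in>I. (b i * y i p) * w i q)" for b p
  have col: "col b q = (\<lambda>p. \<Sum>i\<in>I. (b i * w i q) * w i p)" for b q
    by (simp add: col_def gram_def mult_ac)
  have Qrow: "proj d k E (row b p) q = gram I b y p q" for b p q
    unfolding row_def proj_sum by (simp add: gram_def y_def)
  have Qcol: "proj d k E (col b q) p = row b p q" for b p q
    unfolding col proj_sum by (simp add: row_def y_def mult_ac)
  have fro_gy: "fro2 d (gram I b y) = (\<Sum>p<d. ip d (proj d k E (row b p)) (proj d k E (row b p)))" for b
    by (simp add: fro2_def ip_def Qrow power2_eq_square)
  have rows: "(\<Sum>p<d. ip d (row b p) (row b p)) = (\<Sum>q<d. ip d (proj d k E (col b q)) (proj d k E (col b q)))" for b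
    unfolding ip_def Qcol by (rule sum.swap)
  \<comment> \<open>The columns of \<open>B\<close> lie in the span of the \<open>E j\<close>, so
    projecting the columns already erases \<open>B\<close>; projecting the rows as well only shrinks
    the norm.\<close>
  have le_T: "fro2 d (gram I c y) \<le> fro2 d (\<lambda>p q. gram I c w p q - B p q)"
  proof -
    have "fro2 d (gram I c y) \<le> (\<Sum>p<d. ip d (row c p) (row c p))"
      unfolding fro_gy by (intro sum_mono ip_proj_le[OF E])
    also have "\<dots> \<le> (\<Sum>q<d. ip d (\<lambda>p. gram I c w p q - B p q) (\<lambda>p. gram I c w p q - B p q))"
      unfolding rows
    proof (intro sum_mono)
      fix q assume q: "q \<in> {..<d}"
      have "proj d k E (\<lambda>p. gram I c w p q - B p q) p = proj d k E (col c q) p" if p: "p < d" for p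
      proof -
        have "proj d k E (\<lambda>p. gram I c w p q - B p q) p
          = proj d k E (\<lambda>p. col c q p - (\<Sum>i<k. V i q * U i p)) p"
          using q B p by (intro proj_cong) (auto simp: col_def mult.commute)
        also have "\<dots> = proj d k E (col c q) p - proj d k E (\<lambda>p. \<Sum>i<k. V i q * U i p) p"
          by (simp add: proj_def ip_diff_right left_diff_distrib sum_subtractf)
        also have "\<dots> = proj d k E (col c q) p" unfolding proj_sum using QU p by simp
        finally show ?thesis .
      qed
      then have "ip d (proj d k E (col c q)) (proj d k E (col c q)) =
        ip d (proj d k E (\<lambda>p. gram I c w p q - B p q)) (proj d k E (\<lambda>p. gram I c w p q - B p q))"
        by (simp add: ip_def)
      also have "\<dots> \<le> ip d (\<lambda>p. gram I c w p q - B p q) (\<lambda>p. gram I c w p q - B p q)"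
        by (rule ip_proj_le[OF E])
      finally show "ip d (proj d k E (col c q)) (proj d k E (col c q)) \<le>
        ip d (\<lambda>p. gram I c w p q - B p q) (\<lambda>p. gram I c w p q - B p q)" .
    qed
    also have "\<dots> = fro2 d (\<lambda>p q. gram I c w p q - B p q)"
      unfolding ip_def fro2_def power2_eq_square by (rule sum.swap)
    finally show ?thesis .
  qed
  \<comment> \<open>With \<open>X = gram I a w\<close>, projecting the columns of \<open>X\<close>
    loses the squared norms of the vectors \<open>x j\<close>, the images of the \<open>E j\<close>
    under \<open>X\<close>. Projecting the rows afterwards loses the squared norms of the projected
    \<open>x j\<close>, which are no larger. Hence the factor 2.\<close>
  define x where "x j = mv d (gram I a w) (E j)" for j
  have xx: "ip d (x j) (x j) \<le> \<mu>\<^sup>2" if "j < k" for j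
  proof -
    have "ip d (E j) (E j) \<le> 1" using E that by (auto simp: orthofam_def)
    then have "\<mu>\<^sup>2 * ip d (E j) (E j) \<le> \<mu>\<^sup>2 * 1" by (intro mult_left_mono) auto
    then show ?thesis using \<mu>[of "E j"] by (simp add: x_def)
  qed
  have x: "x j = (\<lambda>p. \<Sum>i\<in>I. (a i * ip d (E j) (w i)) * w i p)" for j
    unfolding x_def mv_gram by (simp add: ip_commute)
  have Ecol: "ip d (E j) (col a q) = x j q" for j q
    unfolding col ip_sum_right x by (simp add: mult_ac)
  have Erow: "ip d (E j) (row a p) = proj d k E (x j) p" for j p
    unfolding row_def ip_sum_right x proj_sum by (simp add: y_def mult_ac)
  have "fro2 d (gram I a w) = (\<Sum>q<d. ip d (col a q) (col a q))"
    unfolding fro2_def ip_def col_def power2_eq_square by (rule sum.swap)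
  also have "\<dots> = (\<Sum>q<d. ip d (proj d k E (col a q)) (proj d k E (col a q)) + (\<Sum>j<k. (ip d (E j) (col a q))\<^sup>2))"
    by (simp add: ip_proj_self[OF E])
  also have "\<dots> = (\<Sum>p<d. ip d (row a p) (row a p)) + (\<Sum>j<k. ip d (x j) (x j))"
    unfolding sum.distrib rows[symmetric] Ecol
    by (subst sum.swap[of _ "{..<k}" "{..<d}"]) (simp add: ip_def power2_eq_square)
  finally have 1: "fro2 d (gram I a w) = (\<Sum>p<d. ip d (row a p) (row a p)) + (\<Sum>j<k. ip d (x j) (x j))" .
  have "(\<Sum>p<d. ip d (row a p) (row a p)) = (\<Sum>p<d. ip d (proj d k E (row a p)) (proj d k E (row a p)) + (\<Sum>j<k. (ip d (E j) (row a p))\<^sup>2))"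
    by (simp add: ip_proj_self[OF E])
  also have "\<dots> = fro2 d (gram I a y) + (\<Sum>j<k. ip d (proj d k E (x j)) (proj d k E (x j)))"
    unfolding sum.distrib fro_gy[symmetric] Erow
    by (subst sum.swap[of _ "{..<k}" "{..<d}"]) (simp add: ip_def power2_eq_square)
  also have "\<dots> \<le> fro2 d (gram I c y) + (\<Sum>j<k. ip d (x j) (x j))"
    by (intro add_mono fro2_gram_mono a sum_mono ip_proj_le[OF E])
  finally have "fro2 d (gram I a w) \<le> fro2 d (gram I c y) + 2 * (\<Sum>j<k. ip d (x j) (x j))"
    using 1 by simp
  moreover have "(\<Sum>j<k. ip d (x j) (x j)) \<le> real k * \<mu>\<^sup>2"
    using sum_bounded_above[of "{..<k}" "\<lambda>j. ip d (x j) (x j)" "\<mu>\<^sup>2"] xx by simp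
  ultimately show ?thesis using le_T by simp
qed

subsection \<open>Cosine matrices and frequency buckets\<close>

text \<open>The phase \<open>b\<close> selects the cosine for \<open>0\<close> and the sine for \<open>1\<close>.\<close>

definition trig :: "(nat \<Rightarrow> real) \<Rightarrow> nat \<times> nat \<Rightarrow> nat \<Rightarrow> real" where
  "trig \<theta> = (\<lambda>(s, b) p. cos (real p * \<theta> s - real b * (pi / 2)))"

abbreviation cos_gram :: "nat set \<Rightarrow> (nat \<Rightarrow> real) \<Rightarrow> (nat \<Rightarrow> real) \<Rightarrow> nat \<Rightarrow> nat \<Rightarrow> real" where
  "cos_gram S a \<theta> \<equiv> gram (S \<times> {0, 1}) (a \<circ> fst) (trig \<theta>)"

text \<open>The addition theorem splits the cosine of a difference into a product of cosines plus a
  product of sines; this is why both phases occur.\<close>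

lemma cos_gram_eq: "cos_gram S a \<theta> p q = (\<Sum>s\<in>S. a s * cos ((real p - real q) * \<theta> s))"
proof -
  have "cos_gram S a \<theta> p q = (\<Sum>s\<in>S. \<Sum>b\<in>{0,1}. a s * trig \<theta> (s, b) p * trig \<theta> (s, b) q)"
    unfolding gram_def by (subst sum.cartesian_product) (simp add: case_prod_unfold)
  also have "\<dots> = (\<Sum>s\<in>S. a s * cos ((real p - real q) * \<theta> s))"
    by (intro sum.cong refl) (simp add: trig_def cos_diff left_diff_distrib algebra_simps)
  finally show ?thesis .
qed

text \<open>Multiplied by \<open>2 * sin (\<phi> / 2)\<close> the Dirichlet sum telescopes to two
  sines. The product form also covers zeros of the sine.\<close>

lemma dirichlet_sum_bound: "\<bar>\<Sum>p<d. cos (real p * \<phi> - \<beta>)\<bar> * \<bar>sin (\<phi> / 2)\<bar> \<le> 1"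
proof -
  have "2 * sin (\<phi> / 2) * (\<Sum>p<d. cos (real p * \<phi> - \<beta>)) = sin ((real d - 1/2) * \<phi> - \<beta>) + sin (\<phi> / 2 + \<beta>)"
  proof (induction d)
    case 0
    have "- \<phi> / 2 - \<beta> = - (\<phi> / 2 + \<beta>)" by simp
    then show ?case using sin_minus[of "\<phi> / 2 + \<beta>"] by simp
  next
    case (Suc d)
    have "2 * sin (\<phi> / 2) * cos (real d * \<phi> - \<beta>) = sin (\<phi> / 2 + (real d * \<phi> - \<beta>)) + sin (\<phi> / 2 - (real d * \<phi> - \<beta>))"
      using sin_times_cos[of "\<phi> / 2" "real d * \<phi> - \<beta>"] by simp
    also have "sin (\<phi> / 2 - (real d * \<phi> - \<beta>)) = - sin ((real d - 1/2) * \<phi> - \<beta>)"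
      by (subst sin_minus[symmetric]) (simp add: algebra_simps)
    also have "\<phi> / 2 + (real d * \<phi> - \<beta>) = (real (Suc d) - 1/2) * \<phi> - \<beta>"
      by (simp add: algebra_simps)
    finally show ?case using Suc by (simp add: distrib_left)
  qed
  moreover have "\<bar>sin ((real d - 1/2) * \<phi> - \<beta>) + sin (\<phi> / 2 + \<beta>)\<bar> \<le> 2"
    using abs_sin_le_one[of "(real d - 1/2) * \<phi> - \<beta>"] abs_sin_le_one[of "\<phi> / 2 + \<beta>"]
    by linarith
  ultimately have "\<bar>2 * sin (\<phi> / 2) * (\<Sum>p<d. cos (real p * \<phi> - \<beta>))\<bar> \<le> 2" by simp
  then show ?thesis by (simp add: abs_mult mult.commute)
qed

text \<open>Jordan's inequality with a weaker constant than 2 / pi: the cubic remainder is at most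
  x^3 / 6, which is at most 2 x / 3 because x is at most 2.\<close>

lemma sin_ge_third:
  assumes "0 \<le> x" "x \<le> pi / 2"
  shows "x / 3 \<le> sin x"
proof -
  obtain t where t: "sin x = (\<Sum>m<3. sin_coeff m * x ^ m) + (sin (t + 1/2 * real 3 * pi) / fact 3) * x ^ 3"
    using Maclaurin_sin_expansion by blast
  define r where "r = sin (t + 1/2 * real 3 * pi) * x ^ 3"
  have x: "x \<le> 2" using assms pi_less_4 by linarith
  have "(- sin (t + 1/2 * real 3 * pi)) * x ^ 3 \<le> 1 * x ^ 3"
    using assms sin_ge_minus_one[of "t + 1/2 * real 3 * pi"] by (intro mult_right_mono) auto
  also have "x ^ 3 \<le> 4 * x"
  proof -
    have "x * x \<le> 2 * 2" using x assms by (intro mult_mono) auto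
    then have "x * (x * x) \<le> x * 4" using assms by (intro mult_left_mono) auto
    then show ?thesis by (simp add: power3_eq_cube)
  qed
  finally have "- r \<le> 4 * x" by (simp add: r_def)
  moreover have "sin x = x + r / 6"
    unfolding t r_def by (simp add: eval_nat_numeral sin_coeff_def fact_numeral)
  ultimately show ?thesis by simp
qed

lemma half_le_cos:
  fixes x :: real
  assumes "\<bar>x\<bar> \<le> 1"
  shows "1 / 2 \<le> cos x"
proof -
  have "\<bar>sin (x / 2)\<bar> \<le> \<bar>x / 2\<bar>" by (rule abs_sin_x_le_abs_x)
  also have "\<dots> \<le> 1 / 2" using assms by simp
  finally have "(sin (x / 2))\<^sup>2 \<le> (1 / 2)\<^sup>2" by (simp add: abs_le_square_iff[symmetric])
  then show ?thesis using cos_double_sin[of "x / 2"] by (simp add: power2_eq_square)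
qed

lemma ip_trig_abs_le: "\<bar>ip d (trig \<theta> i) (trig \<theta> j)\<bar> \<le> real d"
proof -
  have "\<bar>ip d (trig \<theta> i) (trig \<theta> j)\<bar> \<le> (\<Sum>p<d. 1)"
    unfolding ip_def
  proof (intro order_trans[OF sum_abs] sum_mono)
    fix p
    have "\<bar>trig \<theta> i p\<bar> * \<bar>trig \<theta> j p\<bar> \<le> 1 * 1"
      by (intro mult_mono) (auto simp: trig_def case_prod_unfold)
    then show "\<bar>trig \<theta> i p * trig \<theta> j p\<bar> \<le> 1" by (simp add: abs_mult)
  qed
  then show ?thesis by simp
qed

text \<open>The inner product is half a Dirichlet sum at the difference of the frequencies plus half
  of one at their sum. In both cases the sine of half the frequency is at least
  \<open>\<Delta> / 6\<close> in modulus.\<close>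

lemma ip_trig_separated:
  assumes "0 \<le> \<theta> s" "\<theta> s \<le> pi" "0 \<le> \<theta> t" "\<theta> t \<le> pi"
  shows "\<bar>ip d (trig \<theta> (s, b)) (trig \<theta> (t, b'))\<bar> * \<bar>\<theta> s - \<theta> t\<bar> \<le> 6"
proof -
  define \<Delta> where "\<Delta> = \<bar>\<theta> s - \<theta> t\<bar>"
  define A where "A = (\<Sum>p<d. cos (real p * (\<theta> s - \<theta> t) - (real b - real b') * (pi / 2)))"
  define B where "B = (\<Sum>p<d. cos (real p * (\<theta> s + \<theta> t) - (real b + real b') * (pi / 2)))"
  have "ip d (trig \<theta> (s, b)) (trig \<theta> (t, b')) = A / 2 + B / 2"
    unfolding ip_def A_def B_def sum_divide_distrib sum.distrib[symmetric]
  proof (intro sum.cong refl)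
    fix p
    have "real p * (\<theta> s - \<theta> t) - (real b - real b') * (pi / 2) = (real p * \<theta> s - real b * (pi / 2)) - (real p * \<theta> t - real b' * (pi / 2))"
      and "real p * (\<theta> s + \<theta> t) - (real b + real b') * (pi / 2) = (real p * \<theta> s - real b * (pi / 2)) + (real p * \<theta> t - real b' * (pi / 2))"
      by (simp_all only: right_diff_distrib left_diff_distrib distrib_left distrib_right)
    then show "trig \<theta> (s, b) p * trig \<theta> (t, b') p
      = cos (real p * (\<theta> s - \<theta> t) - (real b - real b') * (pi / 2)) / 2 + cos (real p * (\<theta> s + \<theta> t) - (real b + real b') * (pi / 2)) / 2"
      unfolding trig_def by (simp only: prod.case cos_times_cos add_divide_distrib)
  qed
  moreover have "\<bar>A\<bar> * \<Delta> \<le> 6"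
  proof -
    have "\<Delta> / 2 / 3 \<le> sin (\<Delta> / 2)" using assms by (intro sin_ge_third) (auto simp: \<Delta>_def)
    also have "\<dots> \<le> \<bar>sin ((\<theta> s - \<theta> t) / 2)\<bar>"
      by (cases "\<theta> s - \<theta> t \<ge> 0") (auto simp: \<Delta>_def minus_divide_left[symmetric] simp del: minus_diff_eq)
    finally have "\<bar>A\<bar> * (\<Delta> / 2 / 3) \<le> \<bar>A\<bar> * \<bar>sin ((\<theta> s - \<theta> t) / 2)\<bar>"
      by (intro mult_left_mono) auto
    also have "\<dots> \<le> 1" unfolding A_def by (rule dirichlet_sum_bound)
    finally show ?thesis by simp
  qed
  moreover have "\<bar>B\<bar> * \<Delta> \<le> 6"
  proof -
    \<comment> \<open>Both frequencies lie in [0, pi], so their mean \<open>h\<close> has distance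
      at least \<open>\<Delta> / 2\<close> from either zero of the sine.\<close>
    define h where "h = (\<theta> s + \<theta> t) / 2"
    have "\<Delta> / 2 / 3 \<le> sin h"
    proof (cases "h \<le> pi / 2")
      case True
      have "\<Delta> / 2 / 3 \<le> h / 3" using assms by (auto simp: \<Delta>_def h_def)
      also have "\<dots> \<le> sin h" using True assms by (intro sin_ge_third) (auto simp: h_def)
      finally show ?thesis .
    next
      case False
      have "\<Delta> / 2 \<le> pi - h"
        using assms by (auto simp: \<Delta>_def h_def abs_if field_simps)
      then have "\<Delta> / 2 / 3 \<le> (pi - h) / 3" by simp
      also have "\<dots> \<le> sin (pi - h)" using False assms by (intro sin_ge_third) (auto simp: h_def)
      finally show ?thesis by simp
    qed
    also have "\<dots> \<le> \<bar>sin ((\<theta> s + \<theta> t) / 2)\<bar>" by (simp add: h_def)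
    finally have "\<bar>B\<bar> * (\<Delta> / 2 / 3) \<le> \<bar>B\<bar> * \<bar>sin ((\<theta> s + \<theta> t) / 2)\<bar>"
      by (intro mult_left_mono) auto
    also have "\<dots> \<le> 1" unfolding B_def by (rule dirichlet_sum_bound)
    finally show ?thesis by simp
  qed
  moreover have "\<bar>A / 2 + B / 2\<bar> * \<Delta> \<le> (\<bar>A\<bar> / 2 + \<bar>B\<bar> / 2) * \<Delta>"
    by (intro mult_right_mono) (auto simp: \<Delta>_def)
  ultimately show ?thesis by (simp add: \<Delta>_def[symmetric] algebra_simps)
qed

text \<open>The width \<open>1 / d\<close> is the resolution of \<open>d\<close> samples: over them,
  two frequencies of one bucket drift apart by a phase below 1.\<close>

definition bucket :: "nat \<Rightarrow> real \<Rightarrow> nat" where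
  "bucket d x = nat \<lfloor>real d * x\<rfloor>"

lemma bucket_bounds:
  assumes "0 \<le> x"
  shows "real (bucket d x) \<le> real d * x" "real d * x < real (bucket d x) + 1"
  using assms by (auto simp: bucket_def)

lemma bucket_le:
  assumes "0 \<le> x" "x \<le> pi"
  shows "bucket d x \<le> 4 * d"
proof -
  have "real (bucket d x) \<le> real d * 4"
    using bucket_bounds(1)[OF assms(1), of d] mult_left_mono[of x 4 "real d"] assms(2) pi_less_4 by linarith
  then show ?thesis by linarith
qed

text \<open>Bucket indices that differ by \<open>m\<close> force the frequencies at least
  \<open>(m - 1) / d\<close> apart. Adding twice the trivial bound \<open>d\<close> to the resulting
  bound for \<open>z * (m - 1)\<close> covers near and far buckets at once; it gives
  \<open>8 * d\<close>, so 18 is generous.\<close>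

lemma ip_trig_bucket:
  assumes "0 \<le> \<theta> s" "\<theta> s \<le> pi" "0 \<le> \<theta> t" "\<theta> t \<le> pi"
  shows "\<bar>ip d (trig \<theta> (s, b)) (trig \<theta> (t, b'))\<bar>
    \<le> 18 * real d / (\<bar>real (bucket d (\<theta> s)) - real (bucket d (\<theta> t))\<bar> + 1)"
proof -
  define m where "m = \<bar>real (bucket d (\<theta> s)) - real (bucket d (\<theta> t))\<bar>"
  define z where "z = \<bar>ip d (trig \<theta> (s, b)) (trig \<theta> (t, b'))\<bar>"
  have z: "0 \<le> z" "z \<le> real d" using ip_trig_abs_le by (auto simp: z_def)
  have m: "m - 1 \<le> real d * \<bar>\<theta> s - \<theta> t\<bar>"
  proof -
    have "real d * \<bar>\<theta> s - \<theta> t\<bar> = \<bar>real d * \<theta> s - real d * \<theta> t\<bar>"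
      by (simp add: right_diff_distrib[symmetric] abs_mult)
    then show ?thesis
      using bucket_bounds[OF assms(1), of d] bucket_bounds[OF assms(3), of d] unfolding m_def by arith
  qed
  have "z * (m - 1) \<le> z * (real d * \<bar>\<theta> s - \<theta> t\<bar>)" using m z by (intro mult_left_mono)
  also have "\<dots> = real d * (z * \<bar>\<theta> s - \<theta> t\<bar>)" by simp
  also have "\<dots> \<le> real d * 6"
    using ip_trig_separated[OF assms, of d b b'] by (intro mult_left_mono) (auto simp: z_def)
  finally have "z * (m - 1) \<le> real d * 6" .
  then have "z * (m + 1) \<le> 18 * real d" using z by (simp add: algebra_simps)
  then show ?thesis unfolding z_def[symmetric] m_def[symmetric]
    by (subst pos_le_divide_eq) (auto simp: m_def)
qed


section \<open>Summing the decay over the buckets\<close>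

lemma harmonic_le: "(\<Sum>j\<le>n. 1 / (real j + 1)) \<le> 1 + ln (real n + 1)"
proof (induction n)
  case (Suc n)
  have "ln ((real n + 1) / (real n + 2)) \<le> (real n + 1) / (real n + 2) - 1"
    by (intro ln_le_minus_one) auto
  also have "\<dots> = - (1 / (real n + 2))" by (simp add: field_simps)
  finally have "1 / (real n + 2) \<le> ln (real n + 2) - ln (real n + 1)" by (simp add: ln_div)
  then show ?case using Suc by (simp add: add_ac)
qed simp

lemma sum_inverse_distance_le:
  assumes "i \<le> n"
  shows "(\<Sum>j\<le>n. 1 / (\<bar>real i - real j\<bar> + 1)) \<le> 2 * (1 + ln (real n + 1))"
proof -
  have "(\<Sum>j\<le>n. 1 / (\<bar>real i - real j\<bar> + 1)) \<le> (\<Sum>j\<in>{..i} \<union> {i..n}. 1 / (\<bar>real i - real j\<bar> + 1))"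
    by (intro sum_mono2) auto
  also have "\<dots> \<le> (\<Sum>j\<le>i. 1 / (\<bar>real i - real j\<bar> + 1)) + (\<Sum>j\<in>{i..n}. 1 / (\<bar>real i - real j\<bar> + 1))"
    by (subst sum_Un) (auto intro!: sum_nonneg)
  also have "(\<Sum>j\<le>i. 1 / (\<bar>real i - real j\<bar> + 1)) = (\<Sum>j\<le>i. 1 / (real j + 1))"
    by (rule sum.reindex_bij_witness[of _ "\<lambda>j. i - j" "\<lambda>j. i - j"]) (auto simp: of_nat_diff)
  also have "(\<Sum>j\<in>{i..n}. 1 / (\<bar>real i - real j\<bar> + 1)) = (\<Sum>j\<le>n - i. 1 / (real j + 1))"
    using assms by (intro sum.reindex_bij_witness[of _ "\<lambda>j. j + i" "\<lambda>j. j - i"]) (auto simp: of_nat_diff)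
  also have "(\<Sum>j\<le>i. 1 / (real j + 1)) \<le> 1 + ln (real i + 1)" by (rule harmonic_le)
  also have "ln (real i + 1) \<le> ln (real n + 1)" using assms by simp
  also have "(\<Sum>j\<le>n - i. 1 / (real j + 1)) \<le> 1 + ln (real (n - i) + 1)" by (rule harmonic_le)
  also have "ln (real (n - i) + 1) \<le> ln (real n + 1)" by simp
  finally show ?thesis by simp
qed

definition mass :: "nat \<Rightarrow> nat set \<Rightarrow> (nat \<Rightarrow> real) \<Rightarrow> (nat \<Rightarrow> real) \<Rightarrow> nat \<Rightarrow> real" where
  "mass d S a \<theta> j = sum a {s \<in> S. bucket d (\<theta> s) = j}"

text \<open>The constant is 18 from \<open>ip_trig_bucket\<close>, times 2 for the phases, times 2
  for the two sides of the harmonic sum. Bucket indices reach at most \<open>4 * d\<close>, since pi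
  is below 4.\<close>

definition logfac :: "nat \<Rightarrow> real" where
  "logfac d = 72 * (1 + ln (real (4 * d) + 1))"

text \<open>A substitute for the large sieve inequality, which would save the logarithm.\<close>

lemma cos_gram_operator_bound:
  assumes S: "finite S" "\<And>s. s \<in> S \<Longrightarrow> 0 \<le> a s" "\<And>s. s \<in> S \<Longrightarrow> 0 \<le> \<theta> s" "\<And>s. s \<in> S \<Longrightarrow> \<theta> s \<le> pi"
    and \<alpha>: "0 \<le> \<alpha>" "\<And>j. mass d S a \<theta> j \<le> \<alpha>"
  shows "ip d (mv d (cos_gram S a \<theta>) v) (mv d (cos_gram S a \<theta>) v) \<le> (\<alpha> * real d * logfac d)\<^sup>2 * ip d v v"
proof (rule gram_operator_bound)
  fix i assume "i \<in> S \<times> {0::nat, 1}"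
  then show "0 \<le> (a \<circ> fst) i" using S by auto
next
  fix i assume "i \<in> S \<times> {0::nat, 1}"
  then obtain s b where i: "i = (s, b)" "s \<in> S" by auto
  define g where "g j = 18 * real d / (\<bar>real (bucket d (\<theta> s)) - real j\<bar> + 1)" for j
  have "(\<Sum>j\<in>S \<times> {0, 1}. (a \<circ> fst) j * \<bar>ip d (trig \<theta> i) (trig \<theta> j)\<bar>)
    = (\<Sum>t\<in>S. \<Sum>b'\<in>{0, 1}. a t * \<bar>ip d (trig \<theta> (s, b)) (trig \<theta> (t, b'))\<bar>)"
    by (subst sum.cartesian_product) (simp add: case_prod_unfold i)
  also have "\<dots> \<le> (\<Sum>t\<in>S. \<Sum>b'\<in>{0, 1::nat}. a t * g (bucket d (\<theta> t)))"
    unfolding g_def using i S by (intro sum_mono mult_left_mono ip_trig_bucket) auto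
  also have "\<dots> = 2 * (\<Sum>t\<in>S. a t * g (bucket d (\<theta> t)))" by (simp add: sum_distrib_left mult_ac)
  also have "(\<Sum>t\<in>S. a t * g (bucket d (\<theta> t))) = (\<Sum>j\<le>4 * d. \<Sum>t\<in>{t \<in> S. bucket d (\<theta> t) = j}. a t * g (bucket d (\<theta> t)))"
    using S by (intro sum.group[symmetric]) (auto intro: bucket_le)
  also have "\<dots> = (\<Sum>j\<le>4 * d. mass d S a \<theta> j * g j)"
    by (simp add: mass_def sum_distrib_right)
  also have "2 * \<dots> \<le> 2 * (\<Sum>j\<le>4 * d. \<alpha> * g j)"
    using \<alpha> by (intro mult_left_mono sum_mono mult_right_mono) (auto simp: g_def)
  also have "\<dots> = 36 * \<alpha> * real d * (\<Sum>j\<le>4 * d. 1 / (\<bar>real (bucket d (\<theta> s)) - real j\<bar> + 1))"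
    by (simp add: g_def sum_distrib_left mult_ac)
  also have "\<dots> \<le> 36 * \<alpha> * real d * (2 * (1 + ln (real (4 * d) + 1)))"
    using i S \<alpha> by (intro mult_left_mono sum_inverse_distance_le bucket_le) auto
  also have "\<dots> = \<alpha> * real d * logfac d" by (simp add: logfac_def)
  finally show "(\<Sum>j\<in>S \<times> {0, 1}. (a \<circ> fst) j * \<bar>ip d (trig \<theta> i) (trig \<theta> j)\<bar>) \<le> \<alpha> * real d * logfac d" .
qed

section \<open>Lower bounds for the energy of cosine combinations\<close>

lemma cos_gram_inner_product:
  "(\<Sum>p<d. \<Sum>q<d. cos_gram S a \<theta> p q * cos_gram S' b \<theta> p q)
    = (\<Sum>s\<in>S. \<Sum>t\<in>S'. a s * b t * (\<Sum>p<d. \<Sum>q<d. cos ((real p - real q) * \<theta> s) * cos ((real p - real q) * \<theta> t)))"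
proof -
  have "(\<Sum>p<d. \<Sum>q<d. cos_gram S a \<theta> p q * cos_gram S' b \<theta> p q)
    = (\<Sum>p<d. \<Sum>q<d. \<Sum>s\<in>S. \<Sum>t\<in>S'. a s * b t * (cos ((real p - real q) * \<theta> s) * cos ((real p - real q) * \<theta> t)))"
    unfolding cos_gram_eq sum_product by (simp only: mult_ac)
  also have "\<dots> = (\<Sum>p<d. \<Sum>s\<in>S. \<Sum>q<d. \<Sum>t\<in>S'. a s * b t * (cos ((real p - real q) * \<theta> s) * cos ((real p - real q) * \<theta> t)))"
    by (rule sum.cong[OF refl], rule sum.swap)
  also have "\<dots> = (\<Sum>s\<in>S. \<Sum>p<d. \<Sum>q<d. \<Sum>t\<in>S'. a s * b t * (cos ((real p - real q) * \<theta> s) * cos ((real p - real q) * \<theta> t)))"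
    by (rule sum.swap)
  also have "\<dots> = (\<Sum>s\<in>S. \<Sum>p<d. \<Sum>t\<in>S'. \<Sum>q<d. a s * b t * (cos ((real p - real q) * \<theta> s) * cos ((real p - real q) * \<theta> t)))"
    by (rule sum.cong[OF refl], rule sum.cong[OF refl], rule sum.swap)
  also have "\<dots> = (\<Sum>s\<in>S. \<Sum>t\<in>S'. \<Sum>p<d. \<Sum>q<d. a s * b t * (cos ((real p - real q) * \<theta> s) * cos ((real p - real q) * \<theta> t)))"
    by (rule sum.cong[OF refl], rule sum.swap)
  finally show ?thesis by (simp only: sum_distrib_left)
qed

text \<open>The product is \<open>f (x - y) / 2 + f (x + y) / 2\<close>, where \<open>f z\<close> is
  the squared modulus of an exponential sum. Within a bucket every cosine in
  \<open>f (x - y)\<close> is at least 1 / 2.\<close>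

lemma cos_matrix_inner_product_ge:
  fixes x y :: real
  shows "0 \<le> (\<Sum>p<d. \<Sum>q<d. cos ((real p - real q) * x) * cos ((real p - real q) * y))"
    and "0 \<le> x \<Longrightarrow> 0 \<le> y \<Longrightarrow> bucket d x = bucket d y \<Longrightarrow>
      (real d)\<^sup>2 / 4 \<le> (\<Sum>p<d. \<Sum>q<d. cos ((real p - real q) * x) * cos ((real p - real q) * y))"
proof -
  define f where "f z = (\<Sum>p<d. \<Sum>q<d. cos ((real p - real q) * z))" for z
  have f0: "0 \<le> f z" for z
  proof -
    have "f z = (\<Sum>p<d. cos (real p * z)) * (\<Sum>p<d. cos (real p * z)) + (\<Sum>p<d. sin (real p * z)) * (\<Sum>p<d. sin (real p * z))"
      unfolding f_def sum_product sum.distrib[symmetric]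
      by (intro sum.cong refl) (simp add: cos_diff left_diff_distrib)
    then show ?thesis by simp
  qed
  have eq: "(\<Sum>p<d. \<Sum>q<d. cos ((real p - real q) * x) * cos ((real p - real q) * y)) = f (x - y) / 2 + f (x + y) / 2"
    unfolding f_def sum_divide_distrib sum.distrib[symmetric]
    by (intro sum.cong refl) (simp add: cos_times_cos right_diff_distrib distrib_left add_divide_distrib)
  show "0 \<le> (\<Sum>p<d. \<Sum>q<d. cos ((real p - real q) * x) * cos ((real p - real q) * y))"
    unfolding eq using f0 by simp
  assume *: "0 \<le> x" "0 \<le> y" "bucket d x = bucket d y"
  have "(\<Sum>p<d. \<Sum>q<d. 1 / 2) \<le> f (x - y)"
    unfolding f_def
  proof (intro sum_mono half_le_cos)
    fix p q assume "p \<in> {..<d}" "q \<in> {..<d}"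
    then have "\<bar>real p - real q\<bar> \<le> real d" by auto
    then have "\<bar>real p - real q\<bar> * \<bar>x - y\<bar> \<le> real d * \<bar>x - y\<bar>" by (intro mult_right_mono) auto
    also have "\<dots> \<le> 1"
    proof -
      have "real d * \<bar>x - y\<bar> = \<bar>real d * x - real d * y\<bar>"
        by (simp add: right_diff_distrib[symmetric] abs_mult)
      then show ?thesis
        using bucket_bounds[OF *(1), of d] bucket_bounds[OF *(2), of d] unfolding *(3) by arith
    qed
    finally show "\<bar>(real p - real q) * (x - y)\<bar> \<le> 1" by (simp add: abs_mult)
  qed
  then show "(real d)\<^sup>2 / 4 \<le> (\<Sum>p<d. \<Sum>q<d. cos ((real p - real q) * x) * cos ((real p - real q) * y))"
    unfolding eq using f0[of "x + y"] by (simp add: power2_eq_square)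
qed

lemma cos_gram_inner_product_nonneg:
  assumes "\<And>s. s \<in> S \<Longrightarrow> 0 \<le> a s" "\<And>s. s \<in> S' \<Longrightarrow> 0 \<le> b s"
  shows "0 \<le> (\<Sum>p<d. \<Sum>q<d. cos_gram S a \<theta> p q * cos_gram S' b \<theta> p q)"
  unfolding cos_gram_inner_product using assms
  by (intro sum_nonneg mult_nonneg_nonneg cos_matrix_inner_product_ge(1)) auto

text \<open>All pairs of frequencies contribute nonnegatively, so only pairs within a common bucket
  of \<open>H\<close> need to be kept, each worth at least \<open>d^2 / 4\<close>.\<close>

lemma fro2_cos_gram_ge:
  assumes S: "finite S" "\<And>s. s \<in> S \<Longrightarrow> 0 \<le> a s" "\<And>s. s \<in> S \<Longrightarrow> 0 \<le> \<theta> s" and "finite H"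
  shows "(\<Sum>j\<in>H. (mass d S a \<theta> j)\<^sup>2) * (real d)\<^sup>2 / 4 \<le> fro2 d (cos_gram S a \<theta>)"
proof -
  define f where "f s t = (\<Sum>p<d. \<Sum>q<d. cos ((real p - real q) * \<theta> s) * cos ((real p - real q) * \<theta> t))" for s t
  let ?b = "\<lambda>s. bucket d (\<theta> s)"
  have m: "mass d S a \<theta> j = (\<Sum>s\<in>S. if ?b s = j then a s else 0)" for j
    using S(1) unfolding mass_def by (simp add: sum.inter_filter)
  have "(\<Sum>j\<in>H. (mass d S a \<theta> j)\<^sup>2) = (\<Sum>j\<in>H. \<Sum>s\<in>S. \<Sum>t\<in>S. if ?b s = j then if ?b s = ?b t then a s * a t else 0 else 0)"
    unfolding m power2_eq_square sum_product by (intro sum.cong refl) auto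
  also have "\<dots> = (\<Sum>s\<in>S. \<Sum>j\<in>H. \<Sum>t\<in>S. if ?b s = j then if ?b s = ?b t then a s * a t else 0 else 0)"
    by (rule sum.swap)
  also have "\<dots> = (\<Sum>s\<in>S. \<Sum>t\<in>S. \<Sum>j\<in>H. if ?b s = j then if ?b s = ?b t then a s * a t else 0 else 0)"
    by (rule sum.cong[OF refl], rule sum.swap)
  also have "\<dots> \<le> (\<Sum>s\<in>S. \<Sum>t\<in>S. if ?b s = ?b t then a s * a t else 0)"
    using S assms(4) by (intro sum_mono) auto
  finally have "(\<Sum>j\<in>H. (mass d S a \<theta> j)\<^sup>2) * ((real d)\<^sup>2 / 4) \<le> (\<Sum>s\<in>S. \<Sum>t\<in>S. if ?b s = ?b t then a s * a t else 0) * ((real d)\<^sup>2 / 4)"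
    by (intro mult_right_mono) auto
  also have "\<dots> = (\<Sum>s\<in>S. \<Sum>t\<in>S. (if ?b s = ?b t then a s * a t else 0) * ((real d)\<^sup>2 / 4))"
    by (simp only: sum_distrib_right)
  also have "\<dots> \<le> (\<Sum>s\<in>S. \<Sum>t\<in>S. a s * a t * f s t)"
  proof (intro sum_mono)
    fix s t assume st: "s \<in> S" "t \<in> S"
    have "0 \<le> a s * a t" using st S by simp
    moreover have "0 \<le> f s t" unfolding f_def by (rule cos_matrix_inner_product_ge)
    moreover have "(real d)\<^sup>2 / 4 \<le> f s t" if "?b s = ?b t"
      unfolding f_def using that S st by (intro cos_matrix_inner_product_ge) auto
    ultimately show "(if ?b s = ?b t then a s * a t else 0) * ((real d)\<^sup>2 / 4) \<le> a s * a t * f s t"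
      using mult_left_mono[of "(real d)\<^sup>2 / 4" "f s t" "a s * a t"] by simp
  qed
  also have "\<dots> = fro2 d (cos_gram S a \<theta>)"
    unfolding f_def cos_gram_inner_product[symmetric] by (simp add: fro2_def power2_eq_square)
  finally show ?thesis by simp
qed

subsection \<open>Low-rank Toeplitz approximation of a bucket\<close>

definition spanned :: "'i set \<Rightarrow> ('i \<Rightarrow> nat \<Rightarrow> real) \<Rightarrow> (nat \<Rightarrow> real) \<Rightarrow> bool" where
  "spanned A F f \<longleftrightarrow> (\<exists>v. \<forall>p. f p = (\<Sum>i\<in>A. v i * F i p))"

lemma spanned_base:
  assumes "finite A" "i \<in> A"
  shows "spanned A F (F i)"
  unfolding spanned_def
  using assms by (intro exI[of _ "\<lambda>j. if j = i then 1 else 0"]) (simp add: if_distrib[of "\<lambda>x. x * _"] cong: if_cong)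

lemma spanned_scale:
  assumes "spanned A F f"
  shows "spanned A F (\<lambda>p. c * f p)"
proof -
  obtain v where "\<forall>p. f p = (\<Sum>i\<in>A. v i * F i p)" using assms unfolding spanned_def by blast
  then show ?thesis unfolding spanned_def by (intro exI[of _ "\<lambda>i. c * v i"]) (simp add: sum_distrib_left mult_ac)
qed

lemma spanned_add:
  assumes "spanned A F f" "spanned A F g"
  shows "spanned A F (\<lambda>p. f p + g p)"
proof -
  obtain v where "\<forall>p. f p = (\<Sum>i\<in>A. v i * F i p)" using assms unfolding spanned_def by blast
  moreover obtain w where "\<forall>p. g p = (\<Sum>i\<in>A. w i * F i p)" using assms unfolding spanned_def by blast
  ultimately show ?thesis unfolding spanned_def
    by (intro exI[of _ "\<lambda>i. v i + w i"]) (simp add: sum.distrib distrib_right)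
qed

lemma spanned_sum:
  assumes "\<And>j. j \<in> J \<Longrightarrow> spanned A F (f j)"
  shows "spanned A F (\<lambda>p. \<Sum>j\<in>J. f j p)"
  using assms
proof (induction J rule: infinite_finite_induct)
  case (insert x J)
  then show ?case using spanned_add[of A F "f x" "\<lambda>p. \<Sum>j\<in>J. f j p"] by simp
qed (auto simp: spanned_def intro!: exI[of _ "\<lambda>_. 0"])

text \<open>\<open>j / d\<close> is the left end of bucket \<open>j\<close>. Taylor expansion about
  this frequency produces powers of \<open>p\<close> times its cosine and sine.\<close>

definition trig_poly :: "nat \<Rightarrow> nat \<times> nat \<times> nat \<Rightarrow> nat \<Rightarrow> real" where
  "trig_poly d = (\<lambda>(j, e, b) p. real p ^ e * cos (real p * (real j / real d) - real b * (pi / 2)))"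

text \<open>The binomial theorem separates \<open>p\<close> from the shift \<open>x\<close>, later
  the column index; only exponents below \<open>m\<close> arise.\<close>

lemma spanned_shifted_poly:
  assumes "finite H" "j \<in> H" "b \<in> {0, 1}"
  shows "spanned (H \<times> {..<m} \<times> {0, 1}) (trig_poly d)
    (\<lambda>p. cos (real p * (real j / real d) - real b * (pi / 2)) * (\<Sum>i<m. c i * ((real p - x) * h) ^ i))"
proof -
  have eq: "cos (real p * (real j / real d) - real b * (pi / 2)) * (\<Sum>i<m. c i * ((real p - x) * h) ^ i) =
    (\<Sum>i<m. \<Sum>e\<le>i. (c i * h ^ i * real (i choose e) * (- x) ^ (i - e)) * trig_poly d (j, e, b) p)" for p
  proof -
    have "((real p - x) * h) ^ i = h ^ i * (\<Sum>e\<le>i. real (i choose e) * real p ^ e * (- x) ^ (i - e))" for i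
      using binomial_ring[of "real p" "- x" i] by (simp add: power_mult_distrib mult.commute)
    then show ?thesis by (simp add: sum_distrib_left trig_poly_def mult_ac)
  qed
  show ?thesis unfolding eq using assms
    by (intro spanned_sum spanned_scale spanned_base) auto
qed

text \<open>The addition theorem for \<open>cos (r * g + r * h)\<close>, with Taylor polynomials
  only in the small phase \<open>r * h\<close>; the possibly large phase \<open>r * g\<close> stays
  exact. Depending on the difference \<open>r\<close> alone makes the approximant Toeplitz, and
  evenness in \<open>r\<close> makes it symmetric.\<close>

definition taylor_cos :: "nat \<Rightarrow> real \<Rightarrow> real \<Rightarrow> real \<Rightarrow> real" where
  "taylor_cos m g h r = cos (r * g) * (\<Sum>i<m. cos_coeff i * (r * h) ^ i) - sin (r * g) * (\<Sum>i<m. sin_coeff i * (r * h) ^ i)"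

lemma taylor_cos_minus: "taylor_cos m g h (- r) = taylor_cos m g h r"
proof -
  have "cos_coeff i * (- (r * h)) ^ i = cos_coeff i * (r * h) ^ i" for i
    by (cases "even i") (auto simp: cos_coeff_def)
  moreover have "sin_coeff i * (- (r * h)) ^ i = - (sin_coeff i * (r * h) ^ i)" for i
    by (cases "even i") (auto simp: sin_coeff_def)
  ultimately show ?thesis
    by (simp only: taylor_cos_def mult_minus_left cos_minus sin_minus sum_negf mult_minus_right minus_minus)
qed

lemma taylor_cos_error:
  assumes "\<bar>r * h\<bar> \<le> 1"
  shows "\<bar>cos (r * (g + h)) - taylor_cos m g h r\<bar> \<le> 2 / fact m"
proof -
  let ?y = "r * h"
  obtain t where t: "cos ?y = (\<Sum>i<m. cos_coeff i * ?y ^ i) + (cos (t + 1/2 * real m * pi) / fact m) * ?y ^ m"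
    using Maclaurin_cos_expansion by blast
  obtain u where u: "sin ?y = (\<Sum>i<m. sin_coeff i * ?y ^ i) + (sin (u + 1/2 * real m * pi) / fact m) * ?y ^ m"
    using Maclaurin_sin_expansion by blast
  have le: "\<bar>x * (y / fact m * ?y ^ m)\<bar> \<le> 1 / fact m" if "\<bar>x\<bar> \<le> 1" "\<bar>y\<bar> \<le> 1" for x y :: real
  proof -
    have "\<bar>x\<bar> * (\<bar>y\<bar> * \<bar>?y\<bar> ^ m) \<le> 1 * (1 * 1)"
      using that assms power_le_one[of "\<bar>?y\<bar>" m] by (intro mult_mono) auto
    then have "\<bar>x\<bar> * (\<bar>y\<bar> * \<bar>?y\<bar> ^ m) / fact m \<le> 1 / fact m" by (intro divide_right_mono) auto
    then show ?thesis by (simp add: abs_mult power_abs)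
  qed
  have "cos (r * (g + h)) - taylor_cos m g h r =
    cos (r * g) * (cos (t + 1/2 * real m * pi) / fact m * ?y ^ m) - sin (r * g) * (sin (u + 1/2 * real m * pi) / fact m * ?y ^ m)"
    unfolding taylor_cos_def distrib_left cos_add t u by (simp only: algebra_simps)
  also have "\<bar>\<dots>\<bar> \<le> 1 / fact m + 1 / fact m"
    by (intro order_trans[OF abs_triangle_ineq4] add_mono le) auto
  finally show ?thesis by simp
qed

lemma spanned_taylor_cos:
  assumes "finite H" "j \<in> H"
  shows "spanned (H \<times> {..<m} \<times> {0, 1}) (trig_poly d) (\<lambda>p. taylor_cos m (real j / real d) h (real p - x))"
proof -
  let ?g = "real j / real d"
  let ?C = "\<lambda>b p. cos (real p * ?g - real (b::nat) * (pi / 2))"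
  have C: "?C 0 p = cos (real p * ?g)" "?C 1 p = sin (real p * ?g)" for p
    by (auto simp: cos_diff)
  let ?P = "\<lambda>c p. \<Sum>i<m. c i * ((real p - x) * h) ^ i"
  have eq: "taylor_cos m ?g h (real p - x) =
    (cos (x * ?g) * (?C 0 p * ?P cos_coeff p) + sin (x * ?g) * (?C 1 p * ?P cos_coeff p)) +
    (sin (x * ?g) * (?C 0 p * ?P sin_coeff p) + (- cos (x * ?g)) * (?C 1 p * ?P sin_coeff p))" for p
  proof -
    have "taylor_cos m ?g h (real p - x) =
      (cos (real p * ?g) * cos (x * ?g) + sin (real p * ?g) * sin (x * ?g)) * ?P cos_coeff p -
      (sin (real p * ?g) * cos (x * ?g) - cos (real p * ?g) * sin (x * ?g)) * ?P sin_coeff p"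
      by (simp only: taylor_cos_def left_diff_distrib[of _ _ ?g] cos_diff sin_diff)
    moreover have "(c * x + s * y) * P - (s * x - c * y) * R = (x * (c * P) + y * (s * P)) + (y * (c * R) + (- x) * (s * R))"
      for c s x y P R :: real by (simp add: algebra_simps)
    ultimately show ?thesis by (simp only: C)
  qed
  show ?thesis unfolding eq using assms
    by (intro spanned_add spanned_scale spanned_shifted_poly) auto
qed

text \<open>All frequencies of a bucket are expanded about the same left end, so they share
  \<open>2 * m\<close> basis functions, however many they are.\<close>

lemma cos_gram_low_rank_approx:
  assumes S: "finite S" "\<And>s. s \<in> S \<Longrightarrow> 0 \<le> a s" "\<And>s. s \<in> S \<Longrightarrow> 0 \<le> \<theta> s"
    and H: "finite H" "\<And>s. s \<in> S \<Longrightarrow> bucket d (\<theta> s) \<in> H"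
  shows "\<exists>\<rho> V. (\<forall>r. \<rho> (- r) = \<rho> r) \<and>
    (\<forall>p<d. \<forall>q<d. \<bar>cos_gram S a \<theta> p q - \<rho> (real p - real q)\<bar> \<le> sum a S * (2 / fact m)) \<and>
    (\<forall>p q. \<rho> (real p - real q) = (\<Sum>i\<in>H \<times> {..<m} \<times> {0, 1}. V q i * trig_poly d i p))"
proof -
  define g where "g s = real (bucket d (\<theta> s)) / real d" for s
  define \<rho> where "\<rho> r = (\<Sum>s\<in>S. a s * taylor_cos m (g s) (\<theta> s - g s) r)" for r
  have "spanned (H \<times> {..<m} \<times> {0, 1}) (trig_poly d) (\<lambda>p. \<rho> (real p - x))" for x
    unfolding \<rho>_def g_def using H by (intro spanned_sum spanned_scale spanned_taylor_cos) auto
  then have "\<forall>q. \<exists>v. \<forall>p. \<rho> (real p - real q) = (\<Sum>i\<in>H \<times> {..<m} \<times> {0, 1}. v i * trig_poly d i p)"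
    unfolding spanned_def by blast
  from choice[OF this] obtain V where
    V: "\<forall>q p. \<rho> (real p - real q) = (\<Sum>i\<in>H \<times> {..<m} \<times> {0, 1}. V q i * trig_poly d i p)" ..
  have "\<bar>cos_gram S a \<theta> p q - \<rho> (real p - real q)\<bar> \<le> sum a S * (2 / fact m)" if "p < d" "q < d" for p q
  proof -
    let ?r = "real p - real q"
    have "cos_gram S a \<theta> p q - \<rho> ?r = (\<Sum>s\<in>S. a s * (cos (?r * (g s + (\<theta> s - g s))) - taylor_cos m (g s) (\<theta> s - g s) ?r))"
      unfolding cos_gram_eq \<rho>_def by (simp add: sum_subtractf right_diff_distrib)
    also have "\<bar>\<dots>\<bar> \<le> (\<Sum>s\<in>S. a s * (2 / fact m))"
    proof (intro order_trans[OF sum_abs] sum_mono)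
      fix s assume s: "s \<in> S"
      have "\<bar>?r\<bar> \<le> real d" using that by auto
      then have "\<bar>?r * (\<theta> s - g s)\<bar> \<le> real d * \<bar>\<theta> s - g s\<bar>" unfolding abs_mult by (intro mult_right_mono) auto
      also have "\<dots> = \<bar>real d * \<theta> s - real (bucket d (\<theta> s))\<bar>"
      proof -
        have "real d * (\<theta> s - g s) = real d * \<theta> s - real (bucket d (\<theta> s))"
          using that by (simp add: g_def right_diff_distrib)
        then show ?thesis by (metis abs_mult abs_of_nat)
      qed
      also have "\<dots> \<le> 1" using bucket_bounds[OF S(3)[OF s], of d] by arith
      finally have "\<bar>cos (?r * (g s + (\<theta> s - g s))) - taylor_cos m (g s) (\<theta> s - g s) ?r\<bar> \<le> 2 / fact m"
        by (rule taylor_cos_error)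
      then show "\<bar>a s * (cos (?r * (g s + (\<theta> s - g s))) - taylor_cos m (g s) (\<theta> s - g s) ?r)\<bar> \<le> a s * (2 / fact m)"
        unfolding abs_mult using S(2)[OF s] by (simp only: abs_of_nonneg mult_left_mono)
    qed
    finally show ?thesis by (simp only: sum_distrib_right)
  qed
  moreover have "\<rho> (- r) = \<rho> r" for r by (simp add: \<rho>_def taylor_cos_minus)
  ultimately show ?thesis using V by (intro exI[of _ \<rho>] exI[of _ V]) blast
qed

subsection \<open>Norms and ranks\<close>

lemma fro2_L2_set: "sqrt (fro2 d M) = L2_set (\<lambda>(p, q). M p q) ({..<d} \<times> {..<d})"
  by (simp add: fro2_def L2_set_def sum.cartesian_product case_prod_unfold)

lemma fro2_triangle: "sqrt (fro2 d (\<lambda>p q. M p q + N p q)) \<le> sqrt (fro2 d M) + sqrt (fro2 d N)"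
  unfolding fro2_L2_set using L2_set_triangle_ineq[of "\<lambda>(p, q). M p q" "\<lambda>(p, q). N p q"]
  by (simp add: case_prod_unfold)

lemma fro2_le_scaled:
  assumes "\<And>p q. p < d \<Longrightarrow> q < d \<Longrightarrow> \<bar>M p q\<bar> \<le> r * \<bar>N p q\<bar>" "0 \<le> r"
  shows "sqrt (fro2 d M) \<le> r * sqrt (fro2 d N)"
proof -
  have "fro2 d M \<le> (\<Sum>p<d. \<Sum>q<d. r\<^sup>2 * (N p q)\<^sup>2)"
    unfolding fro2_def
  proof (intro sum_mono)
    fix p q assume "p \<in> {..<d}" "q \<in> {..<d}"
    then have "\<bar>M p q\<bar>\<^sup>2 \<le> (r * \<bar>N p q\<bar>)\<^sup>2" using assms by (intro power_mono) auto
    then show "(M p q)\<^sup>2 \<le> r\<^sup>2 * (N p q)\<^sup>2" by (simp add: power_mult_distrib)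
  qed
  also have "\<dots> = r\<^sup>2 * fro2 d N" by (simp add: fro2_def sum_distrib_left)
  finally have "sqrt (fro2 d M) \<le> sqrt (r\<^sup>2 * fro2 d N)" by simp
  then show ?thesis using assms(2) by (simp add: real_sqrt_mult)
qed

lemma fro2_le_entrywise:
  assumes "\<And>p q. p < d \<Longrightarrow> q < d \<Longrightarrow> \<bar>M p q\<bar> \<le> b" "0 \<le> b"
  shows "sqrt (fro2 d M) \<le> real d * b"
proof -
  have "sqrt (fro2 d M) \<le> b * sqrt (fro2 d (\<lambda>_ _. 1))" using assms by (intro fro2_le_scaled) auto
  then show ?thesis by (simp add: fro2_def mult.commute flip: power2_eq_square)
qed

lemma entry_le_fro2:
  assumes "p < d" "q < d"
  shows "\<bar>M p q\<bar> \<le> sqrt (fro2 d M)"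
proof -
  have "(M p q)\<^sup>2 \<le> (\<Sum>q<d. (M p q)\<^sup>2)" using assms by (intro member_le_sum) auto
  also have "\<dots> \<le> fro2 d M" unfolding fro2_def
    using assms member_le_sum[of p "{..<d}" "\<lambda>p. \<Sum>q<d. (M p q)\<^sup>2"] by (simp add: sum_nonneg)
  finally show ?thesis by (simp add: real_le_rsqrt)
qed

lemma rank_le_card:
  fixes M :: "real mat"
  assumes "finite A" "M \<in> carrier_mat d n"
    "\<And>p q. p < d \<Longrightarrow> q < n \<Longrightarrow> M $$ (p, q) = (\<Sum>i\<in>A. V q i * F i p)"
  shows "vec_space.rank d M \<le> card A"
  using assms
proof (induction A arbitrary: M rule: finite_induct)
  case empty
  then have "M = 0\<^sub>m d n" by (intro eq_matI) auto
  then show ?case using vec_space.rank_0I[of d n] by simp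
next
  case (insert x A)
  define M1 where "M1 = mat d n (\<lambda>(p, q). V q x * F x p)"
  define M2 where "M2 = mat d n (\<lambda>(p, q). \<Sum>i\<in>A. V q i * F i p)"
  have "M = M1 + M2" using insert by (intro eq_matI) (auto simp: M1_def M2_def)
  moreover have "vec_space.rank d M1 \<le> 1"
    by (rule vec_space.rank_le_1_product_entries[where nc = n and f = "F x" and g = "\<lambda>q. V q x"]) (auto simp: M1_def)
  moreover have "vec_space.rank d M2 \<le> card A" by (rule insert.IH) (auto simp: M2_def)
  moreover have "vec_space.rank d (M1 + M2) \<le> vec_space.rank d M1 + vec_space.rank d M2"
    by (rule vec_space.rank_subadditive[where nc = n]) (auto simp: M1_def M2_def)
  ultimately show ?case using insert.hyps by simp
qed

section \<open>Factorization of matrices of bounded rank\<close>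

context vec_space
begin

lemma cols_in_span_of_maximal:
  assumes A: "A \<in> carrier_mat n nc"
    and S: "maximal S (\<lambda>T. T \<subseteq> set (cols A) \<and> lin_indpt T)"
    and v: "v \<in> set (cols A)"
  shows "v \<in> span S"
proof (rule ccontr)
  assume nv: "v \<notin> span S"
  have cA: "set (cols A) \<subseteq> carrier_vec n" using cols_dim A by blast
  have SA: "S \<subseteq> set (cols A)" "lin_indpt S" using S by (auto simp: maximal_def)
  have "v \<notin> S" using nv SA cA by (meson in_own_span subset_iff subset_trans)
  moreover have "lin_indpt (S \<union> {v})"
    using lin_dep_iff_in_span[of S v] SA cA v nv calculation by (meson subset_iff subset_trans)
  ultimately show False using S SA v unfolding maximal_def by blast
qed

text \<open>A maximal independent set of columns gives the left factor, padded by zeros to exactly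
  \<open>k\<close> terms.\<close>

lemma low_rank_factorization:
  assumes A: "A \<in> carrier_mat n nc" and r: "rank A \<le> k"
  shows "\<exists>U V. \<forall>p<n. \<forall>q<nc. A $$ (p, q) = (\<Sum>i<k. U i p * V i q)"
proof -
  have cA: "set (cols A) \<subseteq> carrier_vec n" using cols_dim A by blast
  obtain S where S: "maximal S (\<lambda>T. T \<subseteq> set (cols A) \<and> lin_indpt T)"
    using maximal_exists[of "(\<lambda>T. T \<subseteq> set (cols A) \<and> lin_indpt T)" "card (set (cols A))" "{}"]
    by (meson List.finite_set card_mono empty_iff empty_subsetI finite_lin_indpt2 rev_finite_subset)
  have SA: "S \<subseteq> set (cols A)" using S by (auto simp: maximal_def)
  then have finS: "finite S" and Sn: "S \<subseteq> carrier_vec n" using cA by (auto intro: finite_subset)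
  have card: "card S \<le> k" using rank_card_indpt[OF A S] r by simp
  have "\<exists>c. \<forall>p<n. A $$ (p, q) = (\<Sum>v\<in>S. c v * v $ p)" if q: "q < nc" for q
  proof -
    have "col A q \<in> set (cols A)" using A q by (simp add: cols_def)
    then have "col A q \<in> span S" by (rule cols_in_span_of_maximal[OF A S])
    then obtain c where "col A q = lincomb c S" using finite_in_span[OF finS Sn] by metis
    then have "A $$ (p, q) = (\<Sum>v\<in>S. c v * v $ p)" if "p < n" for p
      using lincomb_index[OF that Sn, of c] A q that by (metis carrier_matD index_col)
    then show ?thesis by blast
  qed
  then have "\<forall>q. \<exists>c. q < nc \<longrightarrow> (\<forall>p<n. A $$ (p, q) = (\<Sum>v\<in>S. c v * v $ p))" by blast
  from choice[OF this] obtain C where C: "\<forall>q<nc. \<forall>p<n. A $$ (p, q) = (\<Sum>v\<in>S. C q v * v $ p)" by blast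
  obtain e where e: "bij_betw e {..<card S} S" using ex_bij_betw_nat_finite[OF finS] by (auto simp: atLeast0LessThan)
  define U where "U i p = (if i < card S then e i $ p else 0)" for i p
  have "A $$ (p, q) = (\<Sum>i<k. U i p * C q (e i))" if "p < n" "q < nc" for p q
  proof -
    have "A $$ (p, q) = (\<Sum>i<card S. C q (e i) * e i $ p)"
      using C that by (simp add: sum.reindex_bij_betw[OF e, of "\<lambda>v. C q v * v $ p"])
    also have "\<dots> = (\<Sum>i<card S. U i p * C q (e i))" by (simp add: U_def mult.commute)
    also have "\<dots> = (\<Sum>i<k. U i p * C q (e i))"
      using card by (intro sum.mono_neutral_left) (auto simp: U_def)
    finally show ?thesis .
  qed
  then have "\<forall>p<n. \<forall>q<nc. A $$ (p, q) = (\<Sum>i<k. U i p * C q (e i))" by simp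
  then have "\<exists>V. \<forall>p<n. \<forall>q<nc. A $$ (p, q) = (\<Sum>i<k. U i p * V i q)"
    by (intro exI[of _ "\<lambda>i q. C q (e i)"])
  then show ?thesis by (rule exI[of _ U])
qed

end

section \<open>Selecting the largest values\<close>

lemma exists_top_subset:
  fixes f :: "'a \<Rightarrow> real"
  assumes "finite J" "n \<le> card J"
  shows "\<exists>H\<subseteq>J. card H = n \<and> (\<forall>h\<in>H. \<forall>l\<in>J - H. f l \<le> f h)"
  using assms(2)
proof (induction n)
  case (Suc n)
  then obtain H where H: "H \<subseteq> J" "card H = n" "\<forall>h\<in>H. \<forall>l\<in>J - H. f l \<le> f h" by auto
  have fin: "finite (J - H)" "finite H" using assms(1) H(1) finite_subset by auto
  have ne: "J - H \<noteq> {}"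
  proof
    assume "J - H = {}"
    then have "J = H" using H(1) by blast
    then show False using H(2) Suc.prems by simp
  qed
  obtain x where x: "x \<in> J - H" "\<forall>l\<in>J - H. f l \<le> f x"
    using ex_is_arg_min_if_finite[OF fin(1) ne, of "\<lambda>x. - f x"] by (auto simp: is_arg_min_def not_less)
  have "f l \<le> f h" if "h \<in> insert x H" "l \<in> J - insert x H" for h l
    using that H(3) x(2) by (cases "h = x") simp_all
  moreover have "card (insert x H) = Suc n" "insert x H \<subseteq> J" using H x fin by auto
  ultimately show ?case by (intro exI[of _ "insert x H"]) simp
qed (intro exI[of _ "{}"], simp)

text \<open>\<open>\<alpha>\<close> is the largest value left outside \<open>H\<close>, or 0 if
  nothing is left; so \<open>n * \<alpha>^2\<close> equals the sum of \<open>\<alpha>^2\<close> over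
  \<open>H\<close> even when \<open>H\<close> has fewer than \<open>n\<close> members.\<close>

lemma exists_heavy_subset:
  fixes f :: "'a \<Rightarrow> real"
  assumes "finite J" "\<And>j. j \<in> J \<Longrightarrow> 0 \<le> f j"
  shows "\<exists>H \<alpha>. H \<subseteq> J \<and> card H \<le> n \<and> 0 \<le> \<alpha> \<and> (\<forall>h\<in>H. \<alpha> \<le> f h) \<and>
    (\<forall>l\<in>J - H. f l \<le> \<alpha>) \<and> (card H = n \<or> \<alpha> = 0)"
proof (cases "n \<le> card J")
  case False
  then show ?thesis using assms by (intro exI[of _ J] exI[of _ 0]) auto
next
  case True
  then obtain H where H: "H \<subseteq> J" "card H = n" "\<forall>h\<in>H. \<forall>l\<in>J - H. f l \<le> f h"
    using exists_top_subset[OF assms(1)] by blast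
  show ?thesis
  proof (cases "J - H = {}")
    case True
    then show ?thesis using H assms by (intro exI[of _ H] exI[of _ 0]) auto
  next
    case False
    obtain x where x: "x \<in> J - H" "\<forall>l\<in>J - H. f l \<le> f x"
      using ex_is_arg_min_if_finite[OF _ False, of "\<lambda>x. - f x"] assms(1) by (auto simp: is_arg_min_def not_less)
    then show ?thesis using H assms by (intro exI[of _ H] exI[of _ "f x"]) auto
  qed
qed

subsection \<open>Splitting off the heavy buckets\<close>

lemma mass_nonneg: "(\<And>s. s \<in> S \<Longrightarrow> 0 \<le> a s) \<Longrightarrow> 0 \<le> mass d S a \<theta> j"
  unfolding mass_def by (intro sum_nonneg) auto

lemma cos_gram_add: "cos_gram S (\<lambda>s. a s + b s) \<theta> p q = cos_gram S a \<theta> p q + cos_gram S b \<theta> p q"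
  unfolding cos_gram_eq by (simp add: sum.distrib distrib_right)

text \<open>\<open>H\<close> consists of the \<open>n\<close> heaviest buckets and \<open>\<alpha>\<close> separates their masses from the others. The
  second bound comes from the heavy part with every bucket scaled down to mass exactly \<open>\<alpha>\<close>: this
  trimmed part is dominated by the whole but has small operator norm, so it cannot be captured in
  rank \<open>k\<close>.\<close>

lemma heavy_light_split:
  fixes c \<theta> :: "nat \<Rightarrow> real"
  assumes S: "finite S" "\<And>s. s \<in> S \<Longrightarrow> 0 \<le> c s" "\<And>s. s \<in> S \<Longrightarrow> 0 \<le> \<theta> s" "\<And>s. s \<in> S \<Longrightarrow> \<theta> s \<le> pi"
    and B: "\<And>p q. p < d \<Longrightarrow> q < d \<Longrightarrow> B p q = (\<Sum>i<k. U i p * V i q)"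
  shows "\<exists>H \<alpha>. finite H \<and> card H \<le> n \<and> 0 \<le> \<alpha> \<and>
    (let L = (\<lambda>s. if bucket d (\<theta> s) \<in> H then 0 else c s);
         M = (\<lambda>s. if bucket d (\<theta> s) \<in> H then c s else 0);
         R = fro2 d (\<lambda>p q. cos_gram S c \<theta> p q - B p q) + 2 * real k * (\<alpha> * real d * logfac d)\<^sup>2
     in fro2 d (cos_gram S L \<theta>) \<le> R \<and> real n * \<alpha>\<^sup>2 * (real d)\<^sup>2 / 4 \<le> R \<and>
        real n * \<alpha>\<^sup>2 * (real d)\<^sup>2 / 4 \<le> fro2 d (cos_gram S M \<theta>) \<and>
        fro2 d (cos_gram S L \<theta>) + fro2 d (cos_gram S M \<theta>) \<le> fro2 d (cos_gram S c \<theta>))"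
proof -
  let ?b = "\<lambda>s. bucket d (\<theta> s)"
  define f where "f = mass d S c \<theta>"
  have f0: "0 \<le> f j" for j unfolding f_def using S by (intro mass_nonneg) auto
  obtain H \<alpha> where H: "H \<subseteq> {..4 * d}" "card H \<le> n" "0 \<le> \<alpha>" "\<forall>h\<in>H. \<alpha> \<le> f h"
    "\<forall>l\<in>{..4 * d} - H. f l \<le> \<alpha>" "card H = n \<or> \<alpha> = 0"
    using exists_heavy_subset[of "{..4 * d}" f n] f0 by blast
  have finH: "finite H" using H(1) finite_subset by blast
  define L where "L s = (if ?b s \<in> H then 0 else c s)" for s
  define M where "M s = (if ?b s \<in> H then c s else 0)" for s
  \<comment> \<open>If \<open>f j = 0\<close> for some \<open>j\<close> in \<open>H\<close>, then
    \<open>\<alpha> \<le> f j\<close> gives \<open>\<alpha> = 0\<close>, so the default value 0 of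
    the quotient is the right one.\<close>
  define W where "W s = (if ?b s \<in> H then \<alpha> / f (?b s) * c s else 0)" for s
  have massL: "mass d S L \<theta> j \<le> \<alpha>" for j
  proof (cases "j \<in> {..4 * d} - H")
    case True
    then have "mass d S L \<theta> j = f j" unfolding mass_def f_def by (intro sum.cong) (auto simp: L_def)
    then show ?thesis using H(5) True by simp
  next
    case False
    then have "mass d S L \<theta> j = 0"
      unfolding mass_def using S bucket_le by (intro sum.neutral) (auto simp: L_def)
    then show ?thesis using H by simp
  qed
  have massM: "mass d S M \<theta> j = f j" if "j \<in> H" for j
    unfolding mass_def f_def using that by (intro sum.cong) (auto simp: M_def)
  have massW: "mass d S W \<theta> j = (if j \<in> H then \<alpha> else 0)" for j
  proof (cases "j \<in> H")
    case True
    then have "mass d S W \<theta> j = (\<Sum>s\<in>{s \<in> S. ?b s = j}. \<alpha> / f j * c s)"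
      unfolding mass_def by (intro sum.cong) (auto simp: W_def)
    also have "\<dots> = \<alpha> / f j * f j" by (simp add: f_def mass_def sum_distrib_left)
    also have "\<dots> = \<alpha>" using H(3,4) True by (cases "f j = 0") auto
    finally show ?thesis using True by simp
  next
    case False
    then show ?thesis unfolding mass_def by (auto intro!: sum.neutral simp: W_def)
  qed
  have ratio: "0 \<le> \<alpha> / f j" "\<alpha> / f j \<le> 1" if "j \<in> H" for j
    using H(3,4) f0[of j] that by (auto simp: divide_le_eq_1 intro: order.antisym)
  have LM: "0 \<le> L s" "L s \<le> c s" "0 \<le> M s" "0 \<le> W s" "W s \<le> c s" if "s \<in> S" for s
  proof -
    note cs = S(2)[OF that]
    show "0 \<le> L s" "L s \<le> c s" "0 \<le> M s" using cs by (auto simp: L_def M_def)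
    have "0 \<le> x * c s" "x * c s \<le> c s" if "0 \<le> x" "x \<le> 1" for x
      using that cs by (auto intro: mult_left_le_one_le)
    from this[OF ratio[of "?b s"]] show "0 \<le> W s" "W s \<le> c s" using cs by (auto simp: W_def)
  qed
  define R where "R = fro2 d (\<lambda>p q. cos_gram S c \<theta> p q - B p q) + 2 * real k * (\<alpha> * real d * logfac d)\<^sup>2"
  have le_R: "fro2 d (cos_gram S a \<theta>) \<le> R"
    if a: "\<And>s. s \<in> S \<Longrightarrow> 0 \<le> a s" "\<And>s. s \<in> S \<Longrightarrow> a s \<le> c s" and m: "\<And>j. mass d S a \<theta> j \<le> \<alpha>" for a
    unfolding R_def
    by (rule fro2_le_low_rank_residual[OF _ _ B]; (rule cos_gram_operator_bound)?) (use a S H(3) m in auto)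
  have R1: "fro2 d (cos_gram S L \<theta>) \<le> R" using LM massL by (intro le_R)
  have sum_const: "real n * \<alpha>\<^sup>2 = (\<Sum>j\<in>H. \<alpha>\<^sup>2)" using H(6) by auto
  have R2: "real n * \<alpha>\<^sup>2 * (real d)\<^sup>2 / 4 \<le> R"
  proof -
    have "real n * \<alpha>\<^sup>2 = (\<Sum>j\<in>H. (mass d S W \<theta> j)\<^sup>2)" unfolding sum_const by (simp add: massW)
    then have "real n * \<alpha>\<^sup>2 * (real d)\<^sup>2 / 4 \<le> fro2 d (cos_gram S W \<theta>)"
      using fro2_cos_gram_ge[of S W \<theta> H d] S finH LM by simp
    also have "\<dots> \<le> R" using LM massW H(3) by (intro le_R) auto
    finally show ?thesis .
  qed
  have R3: "real n * \<alpha>\<^sup>2 * (real d)\<^sup>2 / 4 \<le> fro2 d (cos_gram S M \<theta>)"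
  proof -
    have "real n * \<alpha>\<^sup>2 \<le> (\<Sum>j\<in>H. (mass d S M \<theta> j)\<^sup>2)"
      unfolding sum_const using H by (intro sum_mono power_mono) (auto simp: massM)
    then have "real n * \<alpha>\<^sup>2 * (real d)\<^sup>2 / 4 \<le> (\<Sum>j\<in>H. (mass d S M \<theta> j)\<^sup>2) * (real d)\<^sup>2 / 4"
      by (intro divide_right_mono mult_right_mono) auto
    also have "\<dots> \<le> fro2 d (cos_gram S M \<theta>)"
      using S finH LM by (intro fro2_cos_gram_ge) auto
    finally show ?thesis .
  qed
  \<comment> \<open>An inequality in place of Pythagoras: the two parts are not orthogonal, but
    their Frobenius product is nonnegative.\<close>
  have R4: "fro2 d (cos_gram S L \<theta>) + fro2 d (cos_gram S M \<theta>) \<le> fro2 d (cos_gram S c \<theta>)"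
  proof -
    have "c = (\<lambda>s. L s + M s)" by (auto simp: L_def M_def)
    then have c: "cos_gram S c \<theta> p q = cos_gram S L \<theta> p q + cos_gram S M \<theta> p q" for p q
      by (metis cos_gram_add)
    have "fro2 d (cos_gram S c \<theta>) = fro2 d (cos_gram S L \<theta>) + fro2 d (cos_gram S M \<theta>)
      + 2 * (\<Sum>p<d. \<Sum>q<d. cos_gram S L \<theta> p q * cos_gram S M \<theta> p q)"
      unfolding fro2_def c by (simp add: power2_sum sum.distrib sum_distrib_left mult.assoc)
    then show ?thesis using cos_gram_inner_product_nonneg[where S = S and a = L and S' = S and b = M and d = d and \<theta> = \<theta>] LM by simp
  qed
  show ?thesis
    using finH H(2,3) R1 R2 R3 R4
    by (intro exI[of _ H] exI[of _ \<alpha>]) (simp add: Let_def L_def[abs_def] M_def[abs_def] R_def)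
qed

text \<open>\<open>E\<close> is the squared distance of the cosine combination from
  \<open>B\<close>; \<open>l\<close> and \<open>h\<close> are the energies of its light and heavy
  part. The light part is discarded and appears as \<open>sqrt l\<close> in the error. The
  quantities are passed on unevaluated, since the two ranges of \<open>\<delta>\<close> balance them
  differently.\<close>

lemma psd_seq_toeplitz_approx:
  assumes t: "psd_seq d t" and d: "0 < d" and \<tau>: "0 < \<tau>"
    and B: "\<And>p q. p < d \<Longrightarrow> q < d \<Longrightarrow> B p q = (\<Sum>i<k. U i p * V i q)"
  defines "T \<equiv> \<lambda>p q. t ((p - q) + (q - p))"
  shows "\<exists>\<rho> (A :: (nat \<times> nat \<times> nat) set) F W \<alpha> E l h. (\<forall>r. \<rho> (- r) = \<rho> r) \<and> finite A \<and> card A \<le> 2 * n * m \<and>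
    (\<forall>p q. \<rho> (real p - real q) = (\<Sum>i\<in>A. W q i * F i p)) \<and>
    0 \<le> \<alpha> \<and> 0 \<le> E \<and> 0 \<le> l \<and> 0 \<le> h \<and>
    sqrt E \<le> sqrt (fro2 d (\<lambda>p q. T p q - B p q)) + \<tau> * sqrt (fro2 d T) \<and>
    sqrt (fro2 d (\<lambda>p q. T p q - \<rho> (real p - real q))) \<le> sqrt l + (\<tau> + 2 * real d / fact m) * sqrt (fro2 d T) \<and>
    l + h \<le> fro2 d T \<and>
    l \<le> E + 2 * real k * (\<alpha> * real d * logfac d)\<^sup>2 \<and>
    real n * \<alpha>\<^sup>2 * (real d)\<^sup>2 / 4 \<le> E + 2 * real k * (\<alpha> * real d * logfac d)\<^sup>2 \<and>
    real n * \<alpha>\<^sup>2 * (real d)\<^sup>2 / 4 \<le> h"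
proof -
  obtain N c \<theta> where c: "\<forall>j<N::nat. 0 \<le> c j \<and> 0 \<le> \<theta> j \<and> \<theta> j \<le> pi"
    and ct: "\<forall>m<d. \<exists>r. 0 \<le> r \<and> r \<le> \<tau> \<and> r \<le> 1 \<and> (\<Sum>j<N. c j * cos (real m * \<theta> j)) = t m * (1 - r)"
    and c0: "(\<Sum>j<N. c j) = t 0"
    using psd_seq_cosine_approx[OF t d \<tau>] by blast
  let ?S = "{..<N}"
  define G where "G = cos_gram ?S c \<theta>"
  have GT: "\<exists>r. 0 \<le> r \<and> r \<le> \<tau> \<and> r \<le> 1 \<and> G p q = T p q * (1 - r)" if "p < d" "q < d" for p q
  proof -
    have "cos ((real p - real q) * x) = cos (real ((p - q) + (q - p)) * x)" for x
    proof (cases "q \<le> p")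
      case False
      then have "(real p - real q) * x = - (real ((p - q) + (q - p)) * x)" by (simp add: of_nat_diff algebra_simps)
      then show ?thesis by (simp only: cos_minus)
    qed (simp add: of_nat_diff)
    then have "G p q = (\<Sum>j<N. c j * cos (real ((p - q) + (q - p)) * \<theta> j))"
      unfolding G_def cos_gram_eq by (simp only:)
    moreover have "(p - q) + (q - p) < d" using that by auto
    ultimately show ?thesis using ct[rule_format, of "(p - q) + (q - p)"] unfolding T_def by metis
  qed
  have GT1: "\<bar>T p q - G p q\<bar> \<le> \<tau> * \<bar>T p q\<bar>" "\<bar>G p q\<bar> \<le> 1 * \<bar>T p q\<bar>" if pq: "p < d" "q < d" for p q
  proof -
    obtain r where r: "0 \<le> r" "r \<le> \<tau>" "r \<le> 1" "G p q = T p q * (1 - r)" using GT[OF pq] by blast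
    have "T p q - G p q = T p q * r" by (simp add: r algebra_simps)
    then show "\<bar>T p q - G p q\<bar> \<le> \<tau> * \<bar>T p q\<bar>" using r by (simp add: abs_mult mult.commute mult_right_mono)
    show "\<bar>G p q\<bar> \<le> 1 * \<bar>T p q\<bar>" using r by (simp add: abs_mult mult_left_le)
  qed
  have nTG: "sqrt (fro2 d (\<lambda>p q. T p q - G p q)) \<le> \<tau> * sqrt (fro2 d T)"
    using GT1 \<tau> by (intro fro2_le_scaled) auto
  have nG: "fro2 d G \<le> fro2 d T"
  proof -
    have "sqrt (fro2 d G) \<le> 1 * sqrt (fro2 d T)" using GT1 by (intro fro2_le_scaled) auto
    then show ?thesis by simp
  qed
  have "\<exists>H \<alpha>. finite H \<and> card H \<le> n \<and> 0 \<le> \<alpha> \<and>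
    (let L = (\<lambda>s. if bucket d (\<theta> s) \<in> H then 0 else c s);
         M = (\<lambda>s. if bucket d (\<theta> s) \<in> H then c s else 0);
         R = fro2 d (\<lambda>p q. cos_gram ?S c \<theta> p q - B p q) + 2 * real k * (\<alpha> * real d * logfac d)\<^sup>2
     in fro2 d (cos_gram ?S L \<theta>) \<le> R \<and> real n * \<alpha>\<^sup>2 * (real d)\<^sup>2 / 4 \<le> R \<and>
        real n * \<alpha>\<^sup>2 * (real d)\<^sup>2 / 4 \<le> fro2 d (cos_gram ?S M \<theta>) \<and>
        fro2 d (cos_gram ?S L \<theta>) + fro2 d (cos_gram ?S M \<theta>) \<le> fro2 d (cos_gram ?S c \<theta>))"
    by (rule heavy_light_split[OF _ _ _ _ B]) (use c in auto)
  then obtain H \<alpha> where H: "finite H" "card H \<le> n" "0 \<le> \<alpha>" and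
    HL: "let L = (\<lambda>s. if bucket d (\<theta> s) \<in> H then 0 else c s);
         M = (\<lambda>s. if bucket d (\<theta> s) \<in> H then c s else 0);
         R = fro2 d (\<lambda>p q. G p q - B p q) + 2 * real k * (\<alpha> * real d * logfac d)\<^sup>2
     in fro2 d (cos_gram ?S L \<theta>) \<le> R \<and> real n * \<alpha>\<^sup>2 * (real d)\<^sup>2 / 4 \<le> R \<and>
        real n * \<alpha>\<^sup>2 * (real d)\<^sup>2 / 4 \<le> fro2 d (cos_gram ?S M \<theta>) \<and>
        fro2 d (cos_gram ?S L \<theta>) + fro2 d (cos_gram ?S M \<theta>) \<le> fro2 d G"
    unfolding G_def by blast
  define L where "L = (\<lambda>s. if bucket d (\<theta> s) \<in> H then 0 else c s)"
  define M where "M = (\<lambda>s. if bucket d (\<theta> s) \<in> H then c s else 0)"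
  define E where "E = fro2 d (\<lambda>p q. G p q - B p q)"
  note HL = HL[unfolded Let_def, folded L_def M_def E_def]
  define S' where "S' = {s \<in> ?S. bucket d (\<theta> s) \<in> H}"
  have M': "cos_gram ?S M \<theta> p q = cos_gram S' c \<theta> p q" for p q
    unfolding cos_gram_eq S'_def M_def by (subst sum.inter_filter) (auto intro!: sum.cong)
  have "\<exists>\<rho> V. (\<forall>r. \<rho> (- r) = \<rho> r) \<and>
    (\<forall>p<d. \<forall>q<d. \<bar>cos_gram S' c \<theta> p q - \<rho> (real p - real q)\<bar> \<le> sum c S' * (2 / fact m)) \<and>
    (\<forall>p q. \<rho> (real p - real q) = (\<Sum>i\<in>H \<times> {..<m} \<times> {0, 1}. V q i * trig_poly d i p))"
    by (rule cos_gram_low_rank_approx) (use c H in \<open>auto simp: S'_def\<close>)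
  then obtain \<rho> W where \<rho>: "\<forall>r. \<rho> (- r) = \<rho> r"
    "\<forall>p<d. \<forall>q<d. \<bar>cos_gram S' c \<theta> p q - \<rho> (real p - real q)\<bar> \<le> sum c S' * (2 / fact m)"
    "\<forall>p q. \<rho> (real p - real q) = (\<Sum>i\<in>H \<times> {..<m} \<times> {0, 1}. W q i * trig_poly d i p)" by blast
  \<comment> \<open>The weights sum to \<open>t 0\<close>, an entry of \<open>T\<close>. This turns
    the absolute Taylor error into one relative to the norm of \<open>T\<close>.\<close>
  have cS': "0 \<le> sum c S'" "sum c S' \<le> sqrt (fro2 d T)"
  proof -
    show "0 \<le> sum c S'" using c by (auto simp: S'_def intro!: sum_nonneg)
    have "sum c S' \<le> sum c ?S" using c by (intro sum_mono2) (auto simp: S'_def)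
    also have "\<dots> = T 0 0" by (simp add: c0 T_def)
    also have "\<dots> \<le> sqrt (fro2 d T)" using entry_le_fro2[OF d d, of T] by simp
    finally show "sum c S' \<le> sqrt (fro2 d T)" .
  qed
  have nM: "sqrt (fro2 d (\<lambda>p q. cos_gram ?S M \<theta> p q - \<rho> (real p - real q))) \<le> 2 * real d / fact m * sqrt (fro2 d T)"
  proof -
    have "sqrt (fro2 d (\<lambda>p q. cos_gram ?S M \<theta> p q - \<rho> (real p - real q))) \<le> real d * (sum c S' * (2 / fact m))"
      unfolding M' using \<rho>(2) cS' by (intro fro2_le_entrywise) auto
    also have "\<dots> = (2 * real d / fact m) * sum c S'" by simp
    also have "\<dots> \<le> (2 * real d / fact m) * sqrt (fro2 d T)" using cS' by (intro mult_left_mono) auto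
    finally show ?thesis .
  qed
  have G: "G p q = cos_gram ?S L \<theta> p q + cos_gram ?S M \<theta> p q" for p q
    unfolding G_def cos_gram_eq sum.distrib[symmetric] by (intro sum.cong) (auto simp: L_def M_def)
  have n1: "sqrt (fro2 d (\<lambda>p q. T p q - \<rho> (real p - real q))) \<le> sqrt (fro2 d (cos_gram ?S L \<theta>)) + (\<tau> + 2 * real d / fact m) * sqrt (fro2 d T)"
  proof -
    have eq: "(\<lambda>p q. T p q - \<rho> (real p - real q)) =
      (\<lambda>p q. (T p q - G p q) + (cos_gram ?S L \<theta> p q + (cos_gram ?S M \<theta> p q - \<rho> (real p - real q))))"
      by (simp add: G)
    have "sqrt (fro2 d (\<lambda>p q. T p q - \<rho> (real p - real q))) \<le>
      sqrt (fro2 d (\<lambda>p q. T p q - G p q)) + (sqrt (fro2 d (cos_gram ?S L \<theta>)) +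
        sqrt (fro2 d (\<lambda>p q. cos_gram ?S M \<theta> p q - \<rho> (real p - real q))))"
      unfolding eq by (intro order_trans[OF fro2_triangle] add_mono order_refl)
    also have "\<dots> \<le> \<tau> * sqrt (fro2 d T) + (sqrt (fro2 d (cos_gram ?S L \<theta>)) + 2 * real d / fact m * sqrt (fro2 d T))"
      using nTG nM by (intro add_mono order_refl)
    finally show ?thesis by (simp add: distrib_right)
  qed
  have n2: "sqrt E \<le> sqrt (fro2 d (\<lambda>p q. T p q - B p q)) + \<tau> * sqrt (fro2 d T)"
  proof -
    have eq: "(\<lambda>p q. G p q - B p q) = (\<lambda>p q. (T p q - B p q) + (G p q - T p q))" by simp
    have "fro2 d (\<lambda>p q. G p q - T p q) = fro2 d (\<lambda>p q. T p q - G p q)"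
      unfolding fro2_def by (simp add: power2_commute)
    then have "sqrt E \<le> sqrt (fro2 d (\<lambda>p q. T p q - B p q)) + sqrt (fro2 d (\<lambda>p q. T p q - G p q))"
      unfolding E_def eq by (metis fro2_triangle)
    then show ?thesis using nTG by linarith
  qed
  have cardA: "card (H \<times> {..<m} \<times> {0, 1::nat}) \<le> 2 * n * m"
  proof -
    have "card (H \<times> {..<m} \<times> {0, 1::nat}) = card H * (2 * m)" by (simp add: card_cartesian_product)
    also have "\<dots> \<le> n * (2 * m)" using H(2) by (rule mult_le_mono1)
    finally show ?thesis by (simp add: mult_ac)
  qed
  show ?thesis
    by (rule exI[of _ \<rho>], rule exI[of _ "H \<times> {..<m} \<times> {0, 1::nat}"], rule exI[of _ "trig_poly d"], rule exI[of _ W],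
        rule exI[of _ \<alpha>], rule exI[of _ E], rule exI[of _ "fro2 d (cos_gram ?S L \<theta>)"], rule exI[of _ "fro2 d (cos_gram ?S M \<theta>)"])
      (use \<rho> H HL n1 n2 cardA nG in \<open>auto simp: E_def fro2_nonneg\<close>)
qed

subsection \<open>Real estimates and matrices\<close>

lemma two_power_le_fact: "2 ^ n \<le> (fact (Suc n) :: real)"
proof (induction n)
  case (Suc n)
  have "2 * 2 ^ n \<le> (real (Suc (Suc n))) * (fact (Suc n) :: real)"
    using Suc by (intro mult_mono) auto
  then show ?case by simp
qed simp

text \<open>For \<open>n \<ge> 2 * ln x\<close> the chain is
  \<open>x \<le> exp (1 / 2) ^ n \<le> 2 ^ n \<le> fact (Suc n)\<close>; the factor 2 comes from the
  crude \<open>exp (1 / 2) \<le> 2\<close>.\<close>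

lemma exists_taylor_order:
  assumes "1 \<le> x"
  shows "\<exists>m. x \<le> fact m \<and> real m \<le> 2 * ln x + 2"
proof -
  define n where "n = nat \<lceil>2 * ln x\<rceil>"
  have l: "0 \<le> ln x" using assms by simp
  then have n: "2 * ln x \<le> real n" "real n \<le> 2 * ln x + 1" unfolding n_def by linarith+
  have "x = exp (ln x)" using assms by simp
  also have "\<dots> \<le> exp (real n * (1 / 2))" using n by simp
  also have "\<dots> = exp (1 / 2) ^ n" by (rule exp_of_nat_mult)
  also have "\<dots> \<le> 2 ^ n" by (intro power_mono exp_half_le2) auto
  also have "\<dots> \<le> fact (Suc n)" by (rule two_power_le_fact)
  finally show ?thesis using n by (intro exI[of _ "Suc n"]) auto
qed

lemma half_le_ln2: "1 / 2 \<le> ln (2::real)"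
  using exp_half_le2 by (subst ln_ge_iff) auto

lemma one_le_ln_dim: "1 \<le> d \<Longrightarrow> 1 \<le> ln (2 + real d)"
  using exp_le by (subst ln_ge_iff) auto

lemma logfac_le:
  assumes "1 \<le> d"
  shows "logfac d \<le> 216 * ln (2 + real d)" "1 \<le> logfac d"
proof -
  have "ln (real (4 * d) + 1) \<le> ln ((2 + real d)\<^sup>2)"
  proof (subst ln_le_cancel_iff)
    show "0 < (2 + real d)\<^sup>2" by (intro zero_less_power) simp
    show "real (4 * d) + 1 \<le> (2 + real d)\<^sup>2" by (simp add: power2_eq_square algebra_simps)
  qed simp_all
  also have "\<dots> = 2 * ln (2 + real d)" by (simp add: ln_realpow)
  finally show "logfac d \<le> 216 * ln (2 + real d)" "1 \<le> logfac d"
    using one_le_ln_dim[OF assms] by (auto simp: logfac_def)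
qed

text \<open>The 8 pays for \<open>ln (2 + x) ^ 3\<close>, as \<open>ln (2 + x)\<close> is at least 1
  / 2.\<close>

lemma soft_O_ge:
  assumes "0 \<le> x" "0 \<le> C" "real r \<le> C / 8 * real_of_int \<lceil>x\<rceil> * ln (2 + real d) ^ 3"
  shows "real r \<le> soft_O C 3 d x"
proof -
  have "1 / 2 \<le> ln (2 + x)"
  proof -
    have "ln 2 \<le> ln (2 + x)" using assms(1) by simp
    then show ?thesis using half_le_ln2 by linarith
  qed
  then have "(1 / 2) ^ 3 \<le> ln (2 + x) ^ 3" by (intro power_mono) auto
  then have "1 / 8 \<le> ln (2 + x) ^ 3" by (simp add: power_one_over)
  then have "(C * real_of_int \<lceil>x\<rceil> * ln (2 + real d) ^ 3) * (1 / 8) \<le> (C * real_of_int \<lceil>x\<rceil> * ln (2 + real d) ^ 3) * ln (2 + x) ^ 3"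
    using assms by (intro mult_left_mono mult_nonneg_nonneg zero_le_power) (auto simp: ln_ge_zero)
  then show ?thesis using assms(3) by (simp add: soft_O_def mult_ac)
qed

section \<open>From matrices to sequences, and balancing the energies\<close>

lemma frobenius_norm_eq:
  assumes "A \<in> carrier_mat d d" "\<And>p q. p < d \<Longrightarrow> q < d \<Longrightarrow> A $$ (p, q) = M p q"
  shows "frobenius_norm A = sqrt (fro2 d M)"
  unfolding frobenius_norm_def fro2_def using assms by (auto intro!: sum.cong)

lemma toeplitz_psd_seq:
  assumes T: "T \<in> carrier_mat d d" and psd: "psd_mat T" and toep: "toeplitz_mat T"
  defines "t \<equiv> \<lambda>m. T $$ (m, 0)"
  shows "\<And>p q. p < d \<Longrightarrow> q < d \<Longrightarrow> T $$ (p, q) = t ((p - q) + (q - p))" and "psd_seq d t"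
proof -
  have sym: "T $$ (p, q) = T $$ (q, p)" if "p < d" "q < d" for p q
  proof -
    have "transpose_mat T = T" using psd by (auto simp: psd_mat_def sym_mat_def)
    then show ?thesis using T that by (metis carrier_matD index_transpose_mat(1))
  qed
  have lower: "T $$ (p, q) = t (p - q)" if "p < d" "q \<le> p" for p q
    using toep[unfolded toeplitz_mat_def, rule_format, of p q "p - q" 0] T that
    by (auto simp: t_def of_nat_diff)
  show t: "T $$ (p, q) = t ((p - q) + (q - p))" if "p < d" "q < d" for p q
    using lower[of p q] lower[of q p] sym[OF that] that by (cases "q \<le> p") auto
  show "psd_seq d t"
    unfolding psd_seq_def
  proof
    fix v :: "nat \<Rightarrow> real"
    have "0 \<le> vec d v \<bullet> (T *\<^sub>v vec d v)" using psd T by (auto simp: psd_mat_def)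
    also have "\<dots> = (\<Sum>p<d. v p * (\<Sum>q<d. T $$ (p, q) * v q))"
      using T by (auto simp: scalar_prod_def atLeast0LessThan intro!: sum.cong)
    also have "\<dots> = (\<Sum>p<d. \<Sum>q<d. t ((p - q) + (q - p)) * v p * v q)"
      by (simp add: sum_distrib_left t mult_ac)
    finally show "0 \<le> (\<Sum>p<d. \<Sum>q<d. t ((p - q) + (q - p)) * v p * v q)" .
  qed
qed

text \<open>With \<open>Z\<close> the rank \<open>k\<close> loss, the choice of \<open>n\<close> and
  the bound on \<open>\<alpha>\<close> give \<open>2 * Z \<le> \<epsilon> * (E + Z)\<close>. As
  \<open>\<epsilon> < 1\<close>, the \<open>Z\<close> on the right is absorbed and
  \<open>Z \<le> \<epsilon> * E\<close> remains.\<close>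

lemma light_part_small_eps:
  fixes E \<alpha> D L \<epsilon> l :: real
  assumes "0 < \<epsilon>" "\<epsilon> < 1" "0 \<le> E" and n: "16 * real k * L\<^sup>2 / \<epsilon> \<le> real n"
    and l: "l \<le> E + 2 * real k * (\<alpha> * D * L)\<^sup>2"
    and h: "real n * \<alpha>\<^sup>2 * D\<^sup>2 / 4 \<le> E + 2 * real k * (\<alpha> * D * L)\<^sup>2"
  shows "sqrt l \<le> (1 + \<epsilon>) * sqrt E"
proof -
  define Z where "Z = 2 * real k * (\<alpha> * D * L)\<^sup>2"
  have "16 * real k * L\<^sup>2 \<le> \<epsilon> * real n" using n assms(1) by (simp add: field_simps)
  then have "16 * real k * L\<^sup>2 * (\<alpha>\<^sup>2 * D\<^sup>2 / 4) \<le> \<epsilon> * real n * (\<alpha>\<^sup>2 * D\<^sup>2 / 4)" by (rule mult_right_mono) simp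
  then have "2 * Z \<le> \<epsilon> * (real n * \<alpha>\<^sup>2 * D\<^sup>2 / 4)" by (simp add: Z_def power_mult_distrib mult_ac)
  also have "\<dots> \<le> \<epsilon> * (E + Z)" using h assms(1) unfolding Z_def[symmetric] by (intro mult_left_mono) auto
  also have "\<dots> \<le> \<epsilon> * E + Z"
    using assms(2) mult_right_mono[of \<epsilon> 1 Z] by (simp add: distrib_left Z_def)
  finally have "Z \<le> \<epsilon> * E" by simp
  then have "l \<le> (1 + \<epsilon>) * E" using l by (simp add: Z_def[symmetric] distrib_right)
  also have "\<dots> \<le> (1 + \<epsilon>)\<^sup>2 * E" using assms by (intro mult_right_mono) (auto simp: power2_eq_square algebra_simps)
  finally have "sqrt l \<le> sqrt ((1 + \<epsilon>)\<^sup>2 * E)" by simp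
  also have "\<dots> = (1 + \<epsilon>) * sqrt E" using assms by (simp add: real_sqrt_mult)
  finally show ?thesis .
qed

text \<open>If the light part held more than \<open>1 - 4 * \<eta>\<close> of the energy, the heavy
  part would hold less than \<open>4 * \<eta>\<close>. Then \<open>\<alpha>\<close> is so small that
  the loss \<open>Z\<close> is at most \<open>R^2 / 4\<close>, and \<open>l \<le> E + Z\<close> is
  at most \<open>5 / 16 * R^2\<close>, a contradiction. Here \<open>n\<close> is proportional to
  \<open>k * \<eta>\<close>, not to \<open>k\<close>.\<close>

lemma light_part_near_total:
  fixes E \<alpha> D L \<eta> l h R :: real
  assumes \<eta>: "0 < \<eta>" "\<eta> \<le> 1 / 64" and R: "0 \<le> R" and E: "0 \<le> E" "sqrt E \<le> 2 * \<eta> * R"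
    and n: "128 * real k * L\<^sup>2 * \<eta> \<le> real n"
    and l: "l \<le> E + 2 * real k * (\<alpha> * D * L)\<^sup>2"
    and h: "real n * \<alpha>\<^sup>2 * D\<^sup>2 / 4 \<le> h" and lh: "l + h \<le> R\<^sup>2"
  shows "sqrt l \<le> (1 - 2 * \<eta>) * R"
proof -
  define Z where "Z = 2 * real k * (\<alpha> * D * L)\<^sup>2"
  have "128 * real k * L\<^sup>2 * \<eta> * (\<alpha>\<^sup>2 * D\<^sup>2 / 4) \<le> real n * (\<alpha>\<^sup>2 * D\<^sup>2 / 4)" using n by (rule mult_right_mono) simp
  then have Zh: "\<eta> * (16 * Z) \<le> h" using h by (simp add: Z_def power_mult_distrib mult_ac)
  have "(sqrt E)\<^sup>2 \<le> (2 * \<eta> * R)\<^sup>2" using E by (intro power_mono) auto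
  then have "E \<le> (4 * \<eta>\<^sup>2) * R\<^sup>2" using E by (simp add: power_mult_distrib)
  also have "\<dots> \<le> 1 / 16 * R\<^sup>2"
  proof (intro mult_right_mono)
    have "\<eta>\<^sup>2 \<le> (1 / 64)\<^sup>2" using \<eta> by (intro power_mono) auto
    then show "4 * \<eta>\<^sup>2 \<le> 1 / 16" by (simp add: power2_eq_square)
  qed simp
  finally have E': "E \<le> 1 / 16 * R\<^sup>2" .
  have "\<eta> * R\<^sup>2 \<le> 1 / 64 * R\<^sup>2" using \<eta> by (intro mult_right_mono) auto
  have "l \<le> (1 - 4 * \<eta>) * R\<^sup>2"
  proof (rule ccontr)
    assume *: "\<not> l \<le> (1 - 4 * \<eta>) * R\<^sup>2"
    then have "\<eta> * (16 * Z) \<le> \<eta> * (4 * R\<^sup>2)" using Zh lh by (simp add: algebra_simps)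
    then have "16 * Z \<le> 4 * R\<^sup>2" using \<eta>(1) by simp
    then have "l \<le> (1 / 16 + 1 / 4) * R\<^sup>2" using l[folded Z_def] E' by (simp add: algebra_simps)
    then show False using * \<open>\<eta> * R\<^sup>2 \<le> 1 / 64 * R\<^sup>2\<close> zero_le_power2[of R] by (simp add: algebra_simps)
  qed
  also have "\<dots> \<le> (1 - 2 * \<eta>)\<^sup>2 * R\<^sup>2" by (intro mult_right_mono) (auto simp: power2_eq_square algebra_simps)
  finally have "l \<le> ((1 - 2 * \<eta>) * R)\<^sup>2" by (simp add: power_mult_distrib)
  then show ?thesis using \<eta> R by (intro real_le_lsqrt) auto
qed

lemma psd_toeplitz_low_rank_approx:
  assumes T: "T \<in> carrier_mat d d" "psd_mat T" "toeplitz_mat T" and d: "0 < d" and \<tau>: "0 < \<tau>"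
    and B: "B \<in> carrier_mat d d" "vec_space.rank d B \<le> k"
  defines "R \<equiv> frobenius_norm T"
  shows "\<exists>T' \<in> carrier_mat d d. \<exists>\<alpha> E l h. sym_mat T' \<and> toeplitz_mat T' \<and> vec_space.rank d T' \<le> 2 * n * m \<and>
    0 \<le> E \<and> sqrt E \<le> frobenius_norm (T - B) + \<tau> * R \<and>
    frobenius_norm (T - T') \<le> sqrt l + (\<tau> + 2 * real d / fact m) * R \<and>
    l + h \<le> R\<^sup>2 \<and>
    l \<le> E + 2 * real k * (\<alpha> * real d * logfac d)\<^sup>2 \<and>
    real n * \<alpha>\<^sup>2 * (real d)\<^sup>2 / 4 \<le> E + 2 * real k * (\<alpha> * real d * logfac d)\<^sup>2 \<and>
    real n * \<alpha>\<^sup>2 * (real d)\<^sup>2 / 4 \<le> h"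
proof -
  define t where "t m = T $$ (m, 0)" for m
  note t = toeplitz_psd_seq[OF T, folded t_def]
  obtain U V where UV: "\<forall>p<d. \<forall>q<d. B $$ (p, q) = (\<Sum>i<k. U i p * V i q)"
    using vec_space.low_rank_factorization[OF B] by blast
  let ?T = "\<lambda>p q. t ((p - q) + (q - p))"
  have R: "R = sqrt (fro2 d ?T)" unfolding R_def using T(1) t(1) by (rule frobenius_norm_eq)
  have TB: "frobenius_norm (T - B) = sqrt (fro2 d (\<lambda>p q. ?T p q - B $$ (p, q)))"
    using B T(1) t(1) by (intro frobenius_norm_eq) auto
  have R2: "fro2 d ?T = R\<^sup>2" by (simp add: R fro2_nonneg)
  have ex: "\<exists>\<rho> (A :: (nat \<times> nat \<times> nat) set) F W \<alpha> E l h. (\<forall>r. \<rho> (- r) = \<rho> r) \<and> finite A \<and> card A \<le> 2 * n * m \<and>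
    (\<forall>p q. \<rho> (real p - real q) = (\<Sum>i\<in>A. W q i * F i p)) \<and>
    0 \<le> \<alpha> \<and> 0 \<le> E \<and> 0 \<le> l \<and> 0 \<le> h \<and>
    sqrt E \<le> sqrt (fro2 d (\<lambda>p q. ?T p q - B $$ (p, q))) + \<tau> * sqrt (fro2 d ?T) \<and>
    sqrt (fro2 d (\<lambda>p q. ?T p q - \<rho> (real p - real q))) \<le> sqrt l + (\<tau> + 2 * real d / fact m) * sqrt (fro2 d ?T) \<and>
    l + h \<le> fro2 d ?T \<and>
    l \<le> E + 2 * real k * (\<alpha> * real d * logfac d)\<^sup>2 \<and>
    real n * \<alpha>\<^sup>2 * (real d)\<^sup>2 / 4 \<le> E + 2 * real k * (\<alpha> * real d * logfac d)\<^sup>2 \<and>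
    real n * \<alpha>\<^sup>2 * (real d)\<^sup>2 / 4 \<le> h"
    by (rule psd_seq_toeplitz_approx[OF t(2) d \<tau>, where U = U and V = V]) (use UV in blast)
  from ex[unfolded TB[symmetric] R[symmetric], unfolded R2] obtain \<rho> A F W \<alpha> E l h where
    \<rho>: "\<forall>r. \<rho> (- r) = \<rho> r" and A: "finite (A :: (nat \<times> nat \<times> nat) set)" "card A \<le> 2 * n * m" and
    W: "\<forall>p q. \<rho> (real p - real q) = (\<Sum>i\<in>A. W q i * F i p)" and
    bounds: "0 \<le> E" "sqrt E \<le> frobenius_norm (T - B) + \<tau> * R"
      "sqrt (fro2 d (\<lambda>p q. ?T p q - \<rho> (real p - real q))) \<le> sqrt l + (\<tau> + 2 * real d / fact m) * R"
      "l + h \<le> R\<^sup>2"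
      "l \<le> E + 2 * real k * (\<alpha> * real d * logfac d)\<^sup>2"
      "real n * \<alpha>\<^sup>2 * (real d)\<^sup>2 / 4 \<le> E + 2 * real k * (\<alpha> * real d * logfac d)\<^sup>2"
      "real n * \<alpha>\<^sup>2 * (real d)\<^sup>2 / 4 \<le> h"
    by blast
  define T' where "T' = mat d d (\<lambda>(p, q). \<rho> (real p - real q))"
  have T'c: "T' \<in> carrier_mat d d" by (simp add: T'_def)
  have "\<rho> (real q - real p) = \<rho> (real p - real q)" for p q using \<rho>[rule_format, of "real p - real q"] by simp
  then have "sym_mat T'" unfolding sym_mat_def T'_def by (intro eq_matI) auto
  moreover have "toeplitz_mat T'"
    unfolding toeplitz_mat_def
  proof (intro allI impI)
    fix i j k l assume "i < dim_row T'" "j < dim_col T'" "k < dim_row T'" "l < dim_col T'" and eq: "int i - int j = int k - int l"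
    moreover have "real i - real j = real k - real l"
      using arg_cong[OF eq, of real_of_int] by simp
    ultimately show "T' $$ (i, j) = T' $$ (k, l)" by (simp add: T'_def)
  qed
  moreover have "vec_space.rank d T' \<le> 2 * n * m"
    using rank_le_card[OF A(1) T'c, of W F] A(2) W by (simp add: T'_def)
  moreover have "frobenius_norm (T - T') = sqrt (fro2 d (\<lambda>p q. ?T p q - \<rho> (real p - real q)))"
    using T(1) t(1) T'c by (intro frobenius_norm_eq) (auto simp: T'_def)
  ultimately show ?thesis using bounds T'c
    by (intro bexI[of _ T'] exI[of _ \<alpha>] exI[of _ E] exI[of _ l] exI[of _ h]) auto
qed

section \<open>The two ranges of delta\<close>

lemma frobenius_norm_nonneg: "0 \<le> frobenius_norm A"
  by (simp add: frobenius_norm_def sum_nonneg)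

lemma nat_ceiling_bounds:
  fixes x :: real
  assumes "0 \<le> x"
  shows "x \<le> real (nat \<lceil>x\<rceil>)" "real (nat \<lceil>x\<rceil>) \<le> x + 1"
  using assms by linarith+

lemma logfac_squared_le:
  assumes "1 \<le> d"
  shows "(logfac d)\<^sup>2 \<le> 46656 * (ln (2 + real d))\<^sup>2"
proof -
  have "(logfac d)\<^sup>2 \<le> (216 * ln (2 + real d))\<^sup>2"
    using logfac_le[OF assms] by (intro power_mono) auto
  then show ?thesis by (simp add: power_mult_distrib)
qed

text \<open>The restriction on \<open>\<delta>\<close> gives
  \<open>ln (1 / \<delta>) \<ge> 1 / 64\<close>, so the logarithms in the Taylor order that do not
  involve \<open>\<delta>\<close> can be charged to the product
  \<open>\<Lambda> * y\<close>.\<close>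

lemma low_rank_approx_small_delta:
  assumes T: "T \<in> carrier_mat d d" "psd_mat T" "toeplitz_mat T" and d: "1 \<le> d" and k: "1 \<le> k"
    and B: "B \<in> carrier_mat d d" "vec_space.rank d B \<le> k"
    and \<epsilon>: "0 < \<epsilon>" "\<epsilon> < 1" and \<delta>: "0 < \<delta>" "\<delta> \<le> 63 / 64"
  shows "\<exists>T' \<in> carrier_mat d d. sym_mat T' \<and> toeplitz_mat T' \<and>
    real (vec_space.rank d T') \<le> 10 ^ 11 / 8 * (real k * ln (1 / \<delta>) / \<epsilon>) * ln (2 + real d) ^ 3 \<and>
    frobenius_norm (T - T') \<le> (1 + \<epsilon>) * frobenius_norm (T - B) + \<delta> * frobenius_norm T"
proof -
  define R where "R = frobenius_norm T"
  define e where "e = frobenius_norm (T - B)"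
  define \<Lambda> where "\<Lambda> = ln (2 + real d)"
  define y where "y = ln (1 / \<delta>)"
  have \<Lambda>: "1 \<le> \<Lambda>" unfolding \<Lambda>_def using one_le_ln_dim[OF d] .
  have y: "1 / 64 \<le> y" using ln_le_minus_one[of \<delta>] \<delta> by (simp add: y_def ln_div)
  have X: "1 \<le> 16 * real d / \<delta>" using d \<delta> by (simp add: le_divide_eq)
  obtain m where m: "16 * real d / \<delta> \<le> fact m" "real m \<le> 2 * ln (16 * real d / \<delta>) + 2"
    using exists_taylor_order[OF X] by blast
  have m\<Lambda>: "real m \<le> 2178 * \<Lambda> * y"
  proof -
    have "ln (16 * real d / \<delta>) = ln 16 + ln (real d) + y"
      using d \<delta> by (simp add: ln_div ln_mult y_def)
    moreover have "ln 16 \<le> (15 :: real)" using ln_le_minus_one[of 16] by simp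
    moreover have "ln (real d) \<le> \<Lambda>" unfolding \<Lambda>_def using d by simp
    ultimately have "real m \<le> 32 + 2 * \<Lambda> + 2 * y" using m(2) by linarith
    \<comment> \<open>2178 is 32 * 64 + 2 * 64 + 2, by \<open>1 \<le> 64 * y\<close> and
      \<open>1 \<le> \<Lambda>\<close>.\<close>
    also have "\<dots> \<le> 2178 * \<Lambda> * y"
    proof -
      have "1 * y \<le> \<Lambda> * y" "\<Lambda> * (1 / 64) \<le> \<Lambda> * y"
        using \<Lambda> y by (intro mult_right_mono mult_left_mono; simp)+
      then show ?thesis using \<Lambda> by linarith
    qed
    finally show ?thesis .
  qed
  define q where "q = 16 * real k * (logfac d)\<^sup>2 / \<epsilon>"
  define n where "n = nat \<lceil>q\<rceil>"
  have L: "1 \<le> logfac d" using logfac_le[OF d] by simp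
  have q1: "1 \<le> real k * (logfac d)\<^sup>2 / \<epsilon>"
  proof -
    have "1 * 1 \<le> real k * (logfac d)\<^sup>2" using k L by (intro mult_mono one_le_power) auto
    then show ?thesis using \<epsilon> by (simp add: le_divide_eq)
  qed
  have n: "q \<le> real n" "real n \<le> q + 1"
    using nat_ceiling_bounds[of q] \<epsilon> by (auto simp: n_def q_def)
  \<comment> \<open>793152 is 17 * 216^2; the 17 is 16 plus 1 for rounding up.\<close>
  have nk: "real n \<le> 793152 * (real k / \<epsilon>) * \<Lambda>\<^sup>2"
  proof -
    have "real n \<le> 17 * z" if "q = 16 * z" "1 \<le> z" for z using n(2) that by linarith
    from this[OF _ q1] have "real n \<le> 17 * (real k * (logfac d)\<^sup>2 / \<epsilon>)" by (simp add: q_def)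
    then have "real n \<le> 17 * (real k / \<epsilon>) * (logfac d)\<^sup>2" by simp
    also have "\<dots> \<le> 17 * (real k / \<epsilon>) * (46656 * \<Lambda>\<^sup>2)"
      using \<epsilon> logfac_squared_le[OF d] unfolding \<Lambda>_def by (intro mult_left_mono) auto
    finally show ?thesis by simp
  qed
  \<comment> \<open>The discretisation error \<open>\<delta> / 8\<close> enters directly and, at
    most doubled by \<open>1 + \<epsilon>\<close>, through \<open>E\<close>; the Taylor error is at
    most \<open>\<delta> / 8\<close> by the choice of \<open>m\<close>. Together this is
    \<open>\<delta> / 2\<close>.\<close>
  obtain T' \<alpha> E l h where T': "T' \<in> carrier_mat d d" "sym_mat T'" "toeplitz_mat T'" "vec_space.rank d T' \<le> 2 * n * m"
    and E: "0 \<le> E" "sqrt E \<le> e + \<delta> / 8 * R"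
    and err: "frobenius_norm (T - T') \<le> sqrt l + (\<delta> / 8 + 2 * real d / fact m) * R"
    and l: "l \<le> E + 2 * real k * (\<alpha> * real d * logfac d)\<^sup>2"
    and h: "real n * \<alpha>\<^sup>2 * (real d)\<^sup>2 / 4 \<le> E + 2 * real k * (\<alpha> * real d * logfac d)\<^sup>2"
    using psd_toeplitz_low_rank_approx[OF T _ _ B, of "\<delta> / 8" n m] d \<delta> unfolding R_def e_def by auto
  have R0: "0 \<le> R" unfolding R_def by (rule frobenius_norm_nonneg)
  have "sqrt l \<le> (1 + \<epsilon>) * sqrt E"
    using light_part_small_eps[OF \<epsilon> E(1) _ l h] n(1) by (simp add: q_def)
  also have "\<dots> \<le> (1 + \<epsilon>) * (e + \<delta> / 8 * R)" using E(2) \<epsilon> by (intro mult_left_mono) auto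
  also have "\<dots> \<le> (1 + \<epsilon>) * e + 2 * (\<delta> / 8 * R)"
    using \<epsilon> \<delta> R0 mult_right_mono[of "1 + \<epsilon>" 2 "\<delta> / 8 * R"] by (simp add: distrib_left)
  finally have "sqrt l \<le> (1 + \<epsilon>) * e + \<delta> / 4 * R" by (simp add: mult.commute)
  moreover have "(\<delta> / 8 + 2 * real d / fact m) * R \<le> (\<delta> / 4) * R"
  proof (intro mult_right_mono R0)
    have "16 * real d \<le> \<delta> * fact m" using m(1) \<delta> by (simp add: field_simps)
    then have "2 * real d / fact m \<le> \<delta> / 8" by (simp add: field_simps)
    then show "\<delta> / 8 + 2 * real d / fact m \<le> \<delta> / 4" by simp
  qed
  moreover have "0 \<le> \<delta> * R" using \<delta> R0 by simp
  ultimately have "frobenius_norm (T - T') \<le> (1 + \<epsilon>) * e + \<delta> * R" using err by simp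
  moreover have "real (vec_space.rank d T') \<le> 10 ^ 11 / 8 * (real k * y / \<epsilon>) * \<Lambda> ^ 3"
  proof -
    have "real (vec_space.rank d T') \<le> real (2 * n * m)" using T'(4) by (rule of_nat_mono)
    also have "\<dots> = 2 * (real n * real m)" by simp
    also have "\<dots> \<le> 2 * ((793152 * (real k / \<epsilon>) * \<Lambda>\<^sup>2) * (2178 * \<Lambda> * y))"
      using nk m\<Lambda> \<epsilon> by (intro mult_left_mono mult_mono) auto
    also have "\<dots> = 3454970112 * ((real k * y / \<epsilon>) * \<Lambda> ^ 3)"
      by (simp add: power2_eq_square power3_eq_cube)
    also have "\<dots> \<le> 10 ^ 11 / 8 * ((real k * y / \<epsilon>) * \<Lambda> ^ 3)"
      using y \<epsilon> \<Lambda> by (intro mult_right_mono) auto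
    finally show ?thesis by simp
  qed
  ultimately show ?thesis using T' unfolding R_def e_def \<Lambda>_def y_def by blast
qed

text \<open>Here \<open>k ln (1 / \<delta>)\<close> may be far below \<open>k\<close>, so the best rank \<open>k\<close> approximation is out of reach;
  it is only needed that the heaviest buckets carry more than a fraction \<open>1 - \<delta>\<close> of the energy,
  unless the zero matrix already suffices. Raising \<open>1 - \<delta>\<close> to \<open>1 / d\<close> keeps the Taylor order
  logarithmic and costs only \<open>k / d \<le> 1\<close> in the rank.\<close>

lemma low_rank_approx_delta_near_one:
  assumes T: "T \<in> carrier_mat d d" "psd_mat T" "toeplitz_mat T" and d: "64 \<le> d" and k: "1 \<le> k" "k \<le> d"
    and B: "B \<in> carrier_mat d d" "vec_space.rank d B \<le> k"
    and \<delta>: "63 / 64 < \<delta>" "\<delta> < 1" and e: "frobenius_norm (T - B) < (1 - \<delta>) * frobenius_norm T"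
  shows "\<exists>T' \<in> carrier_mat d d. sym_mat T' \<and> toeplitz_mat T' \<and>
    real (vec_space.rank d T') \<le> 10 ^ 10 / 8 * (real k * (1 - \<delta>) + 1) * ln (2 + real d) ^ 3 \<and>
    frobenius_norm (T - T') \<le> \<delta> * frobenius_norm T"
proof -
  define R where "R = frobenius_norm T"
  define \<Lambda> where "\<Lambda> = ln (2 + real d)"
  define \<eta> where "\<eta> = max (1 - \<delta>) (1 / real d)"
  have d1: "1 \<le> d" using d by simp
  have \<Lambda>: "1 \<le> \<Lambda>" unfolding \<Lambda>_def using one_le_ln_dim[OF d1] .
  have R0: "0 \<le> R" unfolding R_def by (rule frobenius_norm_nonneg)
  \<comment> \<open>The two thresholds match: \<open>64 \<le> d\<close> bounds \<open>1 / d\<close>,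
    and \<open>63 / 64 < \<delta>\<close> bounds \<open>1 - \<delta>\<close>.\<close>
  have "\<eta> \<le> 1 / 64" unfolding \<eta>_def using d \<delta> by (intro max.boundedI divide_left_mono) auto
  then have \<eta>: "0 < \<eta>" "\<eta> \<le> 1 / 64" "1 / real d \<le> \<eta>" "1 - \<delta> \<le> \<eta>"
    using d \<delta> by (auto simp: \<eta>_def)
  have k\<eta>: "real k * \<eta> \<le> real k * (1 - \<delta>) + 1"
  proof -
    have "\<eta> \<le> (1 - \<delta>) + 1 / real d" using \<delta> by (auto simp: \<eta>_def)
    then have "real k * \<eta> \<le> real k * ((1 - \<delta>) + 1 / real d)" by (intro mult_left_mono) auto
    also have "\<dots> = real k * (1 - \<delta>) + real k / real d" by (simp add: distrib_left)
    also have "real k / real d \<le> 1" using k d by (simp add: divide_le_eq)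
    finally show ?thesis by simp
  qed
  have X: "1 \<le> 8 * real d / \<eta>" using d \<eta> by (simp add: le_divide_eq)
  obtain m where m: "8 * real d / \<eta> \<le> fact m" "real m \<le> 2 * ln (8 * real d / \<eta>) + 2"
    using exists_taylor_order[OF X] by blast
  \<comment> \<open>As \<open>1 / \<eta> \<le> d\<close>, the order is at most
    \<open>16 + 4 * \<Lambda>\<close>.\<close>
  have m\<Lambda>: "real m \<le> 20 * \<Lambda>"
  proof -
    have "1 / \<eta> \<le> real d" using \<eta> d by (simp add: field_simps)
    then have "8 * real d * (1 / \<eta>) \<le> 8 * real d * real d" by (intro mult_left_mono) auto
    then have "ln (8 * real d / \<eta>) \<le> ln (8 * real d * real d)"
      using d \<eta> by (subst ln_le_cancel_iff) auto
    also have "\<dots> = ln 8 + 2 * ln (real d)" using d by (simp add: ln_mult)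
    also have "\<dots> \<le> 7 + 2 * \<Lambda>"
    proof (intro add_mono mult_left_mono)
      show "ln 8 \<le> (7 :: real)" using ln_le_minus_one[of 8] by simp
      show "ln (real d) \<le> \<Lambda>" unfolding \<Lambda>_def using d by simp
    qed simp
    finally show ?thesis using m(2) \<Lambda> by linarith
  qed
  define q where "q = 128 * real k * (logfac d)\<^sup>2 * \<eta>"
  define n where "n = nat \<lceil>q\<rceil>"
  have n: "q \<le> real n" "real n \<le> q + 1"
    using nat_ceiling_bounds[of q] \<eta> by (auto simp: n_def q_def)
  define x where "x = real k * (1 - \<delta>) + 1"
  have x: "1 \<le> x" using \<delta> by (simp add: x_def)
  have nk: "real n \<le> 129 * x * (46656 * \<Lambda>\<^sup>2)"
  proof -
    have L1: "1 \<le> (logfac d)\<^sup>2" using logfac_le[OF d1] by (intro one_le_power) auto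
    have "q = 128 * (real k * \<eta>) * (logfac d)\<^sup>2" by (simp add: q_def)
    also have "\<dots> \<le> 128 * x * (logfac d)\<^sup>2"
      using k\<eta> unfolding x_def by (intro mult_right_mono mult_left_mono) auto
    finally have "real n \<le> 128 * x * (logfac d)\<^sup>2 + 1 * 1" using n(2) by simp
    also have "1 * 1 \<le> x * (logfac d)\<^sup>2" using x L1 by (intro mult_mono) auto
    finally have "real n \<le> 129 * x * (logfac d)\<^sup>2" by simp
    also have "\<dots> \<le> 129 * x * (46656 * \<Lambda>\<^sup>2)"
      using x logfac_squared_le[OF d1] unfolding \<Lambda>_def by (intro mult_left_mono) auto
    finally show ?thesis .
  qed
  \<comment> \<open>The light part leaves \<open>1 - 2 * \<eta>\<close>; discretisation and Taylor
    errors add \<open>\<eta> / 4\<close> each. The total stays below \<open>1 - \<eta>\<close>,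
    hence below \<open>\<delta>\<close>.\<close>
  obtain T' \<alpha> E l h where T': "T' \<in> carrier_mat d d" "sym_mat T'" "toeplitz_mat T'" "vec_space.rank d T' \<le> 2 * n * m"
    and E: "0 \<le> E" "sqrt E \<le> frobenius_norm (T - B) + \<eta> / 4 * R"
    and err: "frobenius_norm (T - T') \<le> sqrt l + (\<eta> / 4 + 2 * real d / fact m) * R"
    and lh: "l + h \<le> R\<^sup>2" and l: "l \<le> E + 2 * real k * (\<alpha> * real d * logfac d)\<^sup>2"
    and h: "real n * \<alpha>\<^sup>2 * (real d)\<^sup>2 / 4 \<le> h"
    using psd_toeplitz_low_rank_approx[OF T _ _ B, of "\<eta> / 4" n m] d \<eta> unfolding R_def by auto
  have \<eta>R: "(1 - \<delta>) * R \<le> \<eta> * R" "0 \<le> \<eta> * R" using \<eta> R0 by (auto intro: mult_right_mono)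
  have E2: "sqrt E \<le> 2 * \<eta> * R" using E(2) e[folded R_def] \<eta>R by simp
  have "sqrt l \<le> (1 - 2 * \<eta>) * R"
    using light_part_near_total[OF \<eta>(1,2) R0 E(1) E2 _ l h lh] n(1) by (simp add: q_def)
  moreover have "(\<eta> / 4 + 2 * real d / fact m) * R \<le> (\<eta> / 2) * R"
  proof (intro mult_right_mono R0)
    have "8 * real d \<le> \<eta> * fact m" using m(1) \<eta> by (simp add: field_simps)
    then have "2 * real d / fact m \<le> \<eta> / 4" by (simp add: field_simps)
    then show "\<eta> / 4 + 2 * real d / fact m \<le> \<eta> / 2" by simp
  qed
  ultimately have "frobenius_norm (T - T') \<le> \<delta> * R" using err \<eta>R by (simp add: algebra_simps)
  moreover have "real (vec_space.rank d T') \<le> 10 ^ 10 / 8 * x * \<Lambda> ^ 3"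
  proof -
    have "real (vec_space.rank d T') \<le> real (2 * n * m)" using T'(4) by (rule of_nat_mono)
    also have "\<dots> = 2 * (real n * real m)" by simp
    also have "\<dots> \<le> 2 * ((129 * x * (46656 * \<Lambda>\<^sup>2)) * (20 * \<Lambda>))"
      using nk m\<Lambda> x by (intro mult_left_mono mult_mono) auto
    also have "\<dots> = 240744960 * (x * \<Lambda> ^ 3)" by (simp add: power2_eq_square power3_eq_cube)
    also have "\<dots> \<le> 10 ^ 10 / 8 * (x * \<Lambda> ^ 3)" using x \<Lambda> by (intro mult_right_mono) auto
    finally show ?thesis by simp
  qed
  ultimately show ?thesis using T' unfolding R_def x_def \<Lambda>_def by blast
qed

text \<open>The degree 3 counts two logarithms from the square of \<open>logfac\<close> and one from
  the Taylor order. The constant \<open>10 ^ 11\<close> generously covers 8 * 3454970112, the larger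
  of the two ranges of \<open>\<delta>\<close>.\<close>

theorem theorem2:
  shows "\<exists>(C::real) > 0. \<exists>c::nat.
    \<forall>(d::nat) (T::real mat) (\<epsilon>::real) (\<delta>::real) (k::nat) (T\<^sub>k::real mat).
      T \<in> carrier_mat d d \<and> psd_mat T \<and> toeplitz_mat T \<and>
      0 < \<epsilon> \<and> \<epsilon> < 1 \<and> 0 < \<delta> \<and> \<delta> < 1 \<and> k \<le> d \<and> best_rank_approx k T T\<^sub>k \<longrightarrow>
      (\<exists>T' \<in> carrier_mat d d. sym_mat T' \<and> toeplitz_mat T' \<and>
         real (mat_rank T') \<le> soft_O C c d (real k * ln (1 / \<delta>) / \<epsilon>) \<and>
         frobenius_norm (T - T') \<le>
           (1 + \<epsilon>) * frobenius_norm (T - T\<^sub>k) + \<delta> * frobenius_norm T)"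
proof (rule exI[of _ "10 ^ 11"], rule conjI, simp, rule exI[of _ 3], intro allI impI, elim conjE)
  fix d k :: nat and T B :: "real mat" and \<epsilon> \<delta> :: real
  assume T: "T \<in> carrier_mat d d" "psd_mat T" "toeplitz_mat T"
    and \<epsilon>: "0 < \<epsilon>" "\<epsilon> < 1" and \<delta>: "0 < \<delta>" "\<delta> < 1" and k: "k \<le> d" and best: "best_rank_approx k T B"
  have B: "B \<in> carrier_mat d d" "vec_space.rank d B \<le> k"
    using best T(1) by (auto simp: best_rank_approx_def is_arg_min_def)
  let ?x = "real k * ln (1 / \<delta>) / \<epsilon>"
  let ?R = "frobenius_norm T" and ?e = "frobenius_norm (T - B)"
  let ?good = "\<lambda>T'. sym_mat T' \<and> toeplitz_mat T' \<and> real (mat_rank T') \<le> soft_O (10 ^ 11) 3 d ?x \<and>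
    frobenius_norm (T - T') \<le> (1 + \<epsilon>) * ?e + \<delta> * ?R"
  have R0: "0 \<le> ?R" and e0: "0 \<le> ?e" by (rule frobenius_norm_nonneg)+
  have y: "1 - \<delta> \<le> ln (1 / \<delta>)" using ln_le_minus_one[of \<delta>] \<delta> by (simp add: ln_div)
  then have x0: "0 \<le> ?x" using \<epsilon> \<delta> by simp
  have by_rank: "real (mat_rank T') \<le> soft_O (10 ^ 11) 3 d ?x"
    if "T' \<in> carrier_mat d d" "real (vec_space.rank d T') \<le> 10 ^ 11 / 8 * real_of_int \<lceil>?x\<rceil> * ln (2 + real d) ^ 3" for T'
    using soft_O_ge[OF x0 _ that(2)] that(1) by simp
  have \<Lambda>0: "0 \<le> ln (2 + real d) ^ 3" by (intro zero_le_power ln_ge_zero) simp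
  \<comment> \<open>The zero matrix settles \<open>k = 0\<close>, where the rank bound is 0, and
    every case in which the benchmark error is already at least
    \<open>(1 - \<delta>) * ?R\<close>.\<close>
  have zero: "?good (0\<^sub>m d d)" if "?R \<le> (1 + \<epsilon>) * ?e + \<delta> * ?R"
  proof (intro conjI)
    show "sym_mat (0\<^sub>m d d :: real mat)" by (simp add: sym_mat_def)
    show "toeplitz_mat (0\<^sub>m d d :: real mat)" by (simp add: toeplitz_mat_def)
    show "real (mat_rank (0\<^sub>m d d)) \<le> soft_O (10 ^ 11) 3 d ?x"
      using x0 \<Lambda>0 by (intro by_rank) (auto simp: vec_space.rank_0I)
    have "T - 0\<^sub>m d d = T" using T(1) by (intro eq_matI) auto
    then show "frobenius_norm (T - 0\<^sub>m d d) \<le> (1 + \<epsilon>) * ?e + \<delta> * ?R" using that by simp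
  qed
  show "\<exists>T'\<in>carrier_mat d d. ?good T'"
  proof (cases "k = 0")
    case True
    then obtain U V where "\<forall>p<d. \<forall>q<d. B $$ (p, q) = (\<Sum>i<k. U i p * V i q)"
      using vec_space.low_rank_factorization[OF B] by blast
    then have "T - B = T" using True B T(1) by (intro eq_matI) auto
    then have "?R \<le> (1 + \<epsilon>) * ?e + \<delta> * ?R" using R0 \<epsilon> \<delta> by (simp add: distrib_right)
    then show ?thesis using zero by (intro bexI[of _ "0\<^sub>m d d"]) auto
  next
    case False
    then have k1: "1 \<le> k" and d1: "1 \<le> d" using k by auto
    have xpos: "0 < ?x" using k1 \<epsilon> \<delta> y by (intro divide_pos_pos mult_pos_pos) auto
    \<comment> \<open>The rounded argument is at least 1. This pays for \<open>T\<close> itself when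
      \<open>d < 64\<close>, and for the summand 1 in the rank bound when \<open>\<delta>\<close> is
      near 1.\<close>
    then have cx: "1 \<le> real_of_int \<lceil>?x\<rceil>" by (simp add: one_le_ceiling)
    show ?thesis
    proof (cases "\<delta> \<le> 63 / 64")
      case True
      obtain T' where T': "T' \<in> carrier_mat d d" "sym_mat T'" "toeplitz_mat T'"
        "real (vec_space.rank d T') \<le> 10 ^ 11 / 8 * ?x * ln (2 + real d) ^ 3"
        "frobenius_norm (T - T') \<le> (1 + \<epsilon>) * ?e + \<delta> * ?R"
        using low_rank_approx_small_delta[OF T d1 k1 B \<epsilon> \<delta>(1) True] by blast
      note T'(4)
      also have "10 ^ 11 / 8 * ?x * ln (2 + real d) ^ 3 \<le> 10 ^ 11 / 8 * real_of_int \<lceil>?x\<rceil> * ln (2 + real d) ^ 3"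
        using \<Lambda>0 by (intro mult_right_mono mult_left_mono le_of_int_ceiling) auto
      finally show ?thesis using T' by_rank by (intro bexI[of _ T']) auto
    next
      case \<delta>1: False
      show ?thesis
      proof (cases "d < 64")
        case True
        have "real (vec_space.rank d T) \<le> real d" using vec_space.rank_le_nc[OF T(1)] by simp
        also have "\<dots> \<le> 10 ^ 11 / 8 * 1 * 1" using True by simp
        also have "\<dots> \<le> 10 ^ 11 / 8 * real_of_int \<lceil>?x\<rceil> * ln (2 + real d) ^ 3"
          using cx one_le_ln_dim[OF d1] by (intro mult_mono one_le_power mult_left_mono) auto
        finally have "real (mat_rank T) \<le> soft_O (10 ^ 11) 3 d ?x" by (intro by_rank T)
        moreover have "sym_mat T" using T(2) by (simp add: psd_mat_def)
        moreover have "frobenius_norm (T - T) \<le> (1 + \<epsilon>) * ?e + \<delta> * ?R"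
          using T(1) \<epsilon> \<delta> R0 e0 by (simp add: frobenius_norm_def)
        ultimately show ?thesis using T by (intro bexI[of _ T]) auto
      next
        case False
        show ?thesis
        proof (cases "(1 - \<delta>) * ?R \<le> ?e")
          case True
          have "0 \<le> \<epsilon> * ?e" using \<epsilon> e0 by simp
          then have "?R \<le> (1 + \<epsilon>) * ?e + \<delta> * ?R" using True by (simp add: algebra_simps)
          then show ?thesis using zero by (intro bexI[of _ "0\<^sub>m d d"]) auto
        next
          case e: False
          obtain T' where T': "T' \<in> carrier_mat d d" "sym_mat T'" "toeplitz_mat T'"
            "real (vec_space.rank d T') \<le> 10 ^ 10 / 8 * (real k * (1 - \<delta>) + 1) * ln (2 + real d) ^ 3"
            "frobenius_norm (T - T') \<le> \<delta> * ?R"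
            using low_rank_approx_delta_near_one[OF T _ k1 k B _ \<delta>(2)] \<delta>1 False e by auto
          have "1 * (real k * (1 - \<delta>)) \<le> (1 / \<epsilon>) * (real k * ln (1 / \<delta>))"
            using y \<epsilon> \<delta> by (intro mult_mono mult_left_mono) auto
          then have "real k * (1 - \<delta>) \<le> ?x" by simp
          then have "real k * (1 - \<delta>) + 1 \<le> 2 * real_of_int \<lceil>?x\<rceil>"
            using cx le_of_int_ceiling[of ?x] by linarith
          moreover have "10 ^ 10 / 8 * a \<le> 10 ^ 11 / 8 * b" if "a \<le> 2 * b" "1 \<le> b" for a b :: real
            using that by simp
          ultimately have "10 ^ 10 / 8 * (real k * (1 - \<delta>) + 1) \<le> 10 ^ 11 / 8 * real_of_int \<lceil>?x\<rceil>"
            using cx by blast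
          then have "10 ^ 10 / 8 * (real k * (1 - \<delta>) + 1) * ln (2 + real d) ^ 3 \<le> 10 ^ 11 / 8 * real_of_int \<lceil>?x\<rceil> * ln (2 + real d) ^ 3"
            using \<Lambda>0 by (rule mult_right_mono)
          then have "real (mat_rank T') \<le> soft_O (10 ^ 11) 3 d ?x" using order_trans[OF T'(4)] by_rank[OF T'(1)] by blast
          moreover have "0 \<le> (1 + \<epsilon>) * ?e" using \<epsilon> e0 by simp
          ultimately show ?thesis using T' by (intro bexI[of _ T']) auto
        qed
      qed
    qed
  qed
qed

end
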